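(* Let $\Omega\subset\mathbb{H}$ be a symmetric slice domain, $I_0\in\mathbb{S}$, $f\in\mathcal{S}_{I_0}(\Omega)\setminus\mathcal{S}_{\mathbb{R}}(\Omega)$ and $h\in \mathcal{S}(\Omega)\setminus\mathcal{S}_{I_0}(\Omega)$. Let $M_0\in\mathbb{S}$. Then $h*f*h^c\in\mathcal{S}_{M_0}(\Omega)$ if and only if (i) in the case $\mathbb{C}_{I_{0}}\neq \mathbb{C}_{M_{0}}$: with $K_0=\frac{I_0\wedge M_0}{|I_0\wedge M_0|}$, $J_0=K_0I_0$ and $M_0=aI_0+bJ_0$ (where $b>0$, $a^2+b^2=1$), there exists $g\in\mathcal{S}_{I_0}(\Omega)\setminus\{0\}$ such that, for one of the two choices of the sign, $$h=\left(1-\frac{a \pm1}{ b }K_0\right)*g;$$ (ii) in the case $\mathbb{C}_{I_{0}}= \mathbb{C}_{M_{0}}$: there exist $J_0\in\mathbb{S}$ with $I_0\perp J_0$ and $g\in \mathcal{S}_{I_0}(\Omega)\setminus\{0\}$ such that $h=J_0*g$.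
   Context: $\mathbb{H}$ is the algebra of quaternions with standard basis $1,i,j,k$, $\mathrm{Im}\,\mathbb{H}=\mathrm{Span}_{\mathbb{R}}(i,j,k)\simeq\mathbb{R}^3$ (Euclidean, with cross product $\wedge$), $\mathbb{S}=\{q\in\mathbb{H}: q^2=-1\}\subset\mathrm{Im}\,\mathbb{H}$, and $\mathbb{C}_I=\mathrm{Span}_{\mathbb{R}}(1,I)$ for $I\in\mathbb{S}$. A symmetric slice domain $\Omega\subset\mathbb{H}$ is a domain (connected open set) such that $\Omega\cap\mathbb{R}\neq\emptyset$ and, whenever $\alpha+I\beta\in\Omega$ ($\alpha,\beta\in\mathbb{R}$, $I\in\mathbb{S}$), also $\alpha+J\beta\in\Omega$ for all $J\in\mathbb{S}$. A function $f:\Omega\to\mathbb{H}$ is slice regular if for every $J\in\mathbb{S}$ the restriction $f_J$ of $f$ to $\Omega\cap\mathbb{C}_J$ is holomorphic: $\frac12\left(\frac{\partial}{\partial\alpha}+J\frac{\partial}{\partial\beta}\right)f_J(\alpha+J\beta)\equiv0$. $\mathcal{S}(\Omega)$ is the set of slice regular functions on $\Omega$; $\mathcal{S}_{\mathbb{R}}(\Omega)$ is the subset of slice preserving functions, i.e. $f(\Omega\cap\mathbb{C}_I)\subset\mathbb{C}_I$ for all $I\in\mathbb{S}$; $\mathcal{S}_{J}(\Omega)$ is the set of $f\in\mathcal{S}(\Omega)$ with $f(\Omega\cap\mathbb{C}_J)\subset\mathbb{C}_J$. Known fact: every $f\in\mathcal{S}(\Omega)$ is written uniquely as $f=f_0+f_1i+f_2j+f_3k$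 with $f_0,\dots,f_3\in\mathcal{S}_{\mathbb{R}}(\Omega)$. The regular conjugate is $f^c=f_0-f_1i-f_2j-f_3k$. The $*$-product is $f*g=f_0g_0-f_1g_1-f_2g_2-f_3g_3+f_0(g_1i+g_2j+g_3k)+g_0(f_1i+f_2j+f_3k)+(f_2g_3-f_3g_2)i+(f_3g_1-f_1g_3)j+(f_1g_2-f_2g_1)k$ (pointwise products); it is associative. Quaternions are regarded as constant slice regular functions. When $I_0,M_0\in\mathbb{S}$ are linearly independent (i.e. $\mathbb{C}_{I_0}\neq\mathbb{C}_{M_0}$), $I_0,J_0,K_0$ defined in (i) is an orthonormal basis of $\mathrm{Im}\,\mathbb{H}$. *)

theory Defs
  imports "HOL-Analysis.Analysis"
begin

section \<open>Quaternions\<close>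

codatatype quat = Quat (qRe: real) (qIm1: real) (qIm2: real) (qIm3: real)

lemma quat_eqI [intro?]:
  "\<lbrakk>qRe x = qRe y; qIm1 x = qIm1 y; qIm2 x = qIm2 y; qIm3 x = qIm3 y\<rbrakk> \<Longrightarrow> x = y"
  by (rule quat.expand) simp

lemma quat_eq_iff:
  "x = y \<longleftrightarrow> qRe x = qRe y \<and> qIm1 x = qIm1 y \<and> qIm2 x = qIm2 y \<and> qIm3 x = qIm3 y"
  by (auto intro: quat.expand)

instantiation quat :: ring_1
begin

primcorec zero_quat where
  "qRe 0 = 0" | "qIm1 0 = 0" | "qIm2 0 = 0" | "qIm3 0 = 0"

primcorec one_quat where
  "qRe 1 = 1" | "qIm1 1 = 0" | "qIm2 1 = 0" | "qIm3 1 = 0"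

primcorec plus_quat where
  "qRe (x + y) = qRe x + qRe y"
| "qIm1 (x + y) = qIm1 x + qIm1 y"
| "qIm2 (x + y) = qIm2 x + qIm2 y"
| "qIm3 (x + y) = qIm3 x + qIm3 y"

primcorec uminus_quat where
  "qRe (- x) = - qRe x"
| "qIm1 (- x) = - qIm1 x"
| "qIm2 (- x) = - qIm2 x"
| "qIm3 (- x) = - qIm3 x"

primcorec minus_quat where
  "qRe (x - y) = qRe x - qRe y"
| "qIm1 (x - y) = qIm1 x - qIm1 y"
| "qIm2 (x - y) = qIm2 x - qIm2 y"
| "qIm3 (x - y) = qIm3 x - qIm3 y"

primcorec times_quat where
  "qRe (x * y) = qRe x * qRe y - qIm1 x * qIm1 y - qIm2 x * qIm2 y - qIm3 x * qIm3 y"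
| "qIm1 (x * y) = qRe x * qIm1 y + qIm1 x * qRe y + qIm2 x * qIm3 y - qIm3 x * qIm2 y"
| "qIm2 (x * y) = qRe x * qIm2 y - qIm1 x * qIm3 y + qIm2 x * qRe y + qIm3 x * qIm1 y"
| "qIm3 (x * y) = qRe x * qIm3 y + qIm1 x * qIm2 y - qIm2 x * qIm1 y + qIm3 x * qRe y"

instance
  by standard (simp_all add: quat_eq_iff algebra_simps)

end

instantiation quat :: real_algebra_1
begin

primcorec scaleR_quat where
  "qRe (scaleR r x) = r * qRe x"
| "qIm1 (scaleR r x) = r * qIm1 x"
| "qIm2 (scaleR r x) = r * qIm2 x"
| "qIm3 (scaleR r x) = r * qIm3 x"

instance
  by standard (simp_all add: quat_eq_iff algebra_simps)

end

lemma quat_of_real_sel [simp]: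
  "qRe (of_real r) = r" "qIm1 (of_real r) = 0" "qIm2 (of_real r) = 0" "qIm3 (of_real r) = 0"
  by (simp_all add: of_real_def)

definition qnorm2 :: "quat \<Rightarrow> real" where
  "qnorm2 x = (qRe x)\<^sup>2 + (qIm1 x)\<^sup>2 + (qIm2 x)\<^sup>2 + (qIm3 x)\<^sup>2"

lemma qnorm2_eq_0_iff: "qnorm2 x = 0 \<longleftrightarrow> x = 0"
  by (simp add: qnorm2_def quat_eq_iff add_nonneg_eq_0_iff)

instantiation quat :: real_normed_div_algebra
begin

definition norm_quat_def: "norm x = sqrt (qnorm2 x)"

definition sgn_quat_def: "sgn x = x /\<^sub>R norm x" for x :: quat

definition dist_quat_def: "dist x y = norm (x - y)" for x y :: quat

definition uniformity_quat_def [code del]: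
  "(uniformity :: (quat \<times> quat) filter) = (INF e\<in>{0 <..}. principal {(x, y). dist x y < e})"

definition open_quat_def [code del]:
  "open (U :: quat set) \<longleftrightarrow> (\<forall>x\<in>U. eventually (\<lambda>(x', y). x' = x \<longrightarrow> y \<in> U) uniformity)"

primcorec inverse_quat where
  "qRe (inverse x) = qRe x / qnorm2 x"
| "qIm1 (inverse x) = - qIm1 x / qnorm2 x"
| "qIm2 (inverse x) = - qIm2 x / qnorm2 x"
| "qIm3 (inverse x) = - qIm3 x / qnorm2 x"

definition divide_quat_def: "x div y = x * inverse y" for x y :: quat

instance
proof
  fix r :: real and x y :: quat
  show "(norm x = 0) = (x = 0)"
    by (simp add: norm_quat_def qnorm2_eq_0_iff)
  have pair: "norm z = norm (Complex (qRe z) (qIm1 z), Complex (qIm2 z) (qIm3 z))" for z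
    by (simp add: norm_quat_def norm_Pair cmod_power2 qnorm2_def)
  have "norm ((Complex (qRe x) (qIm1 x), Complex (qIm2 x) (qIm3 x)) +
              (Complex (qRe y) (qIm1 y), Complex (qIm2 y) (qIm3 y))) \<le> norm x + norm y"
    unfolding pair by (rule norm_triangle_ineq)
  then show "norm (x + y) \<le> norm x + norm y"
    by (simp add: pair [of "x + y"] complex_add)
  have "qnorm2 (scaleR r x) = r\<^sup>2 * qnorm2 x"
    by (simp add: qnorm2_def power_mult_distrib algebra_simps)
  then show "norm (scaleR r x) = \<bar>r\<bar> * norm x"
    by (simp add: norm_quat_def real_sqrt_mult)
  have "qnorm2 (x * y) = qnorm2 x * qnorm2 y"
    unfolding qnorm2_def times_quat.simps by algebra
  then show "norm (x * y) = norm x * norm y"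
    by (simp add: norm_quat_def real_sqrt_mult)
  have inv: "inverse x = (1 / qnorm2 x) *\<^sub>R Quat (qRe x) (- qIm1 x) (- qIm2 x) (- qIm3 x)"
    by (simp add: quat_eq_iff)
  have "Quat (qRe x) (- qIm1 x) (- qIm2 x) (- qIm3 x) * x = qnorm2 x *\<^sub>R 1"
    "x * Quat (qRe x) (- qIm1 x) (- qIm2 x) (- qIm3 x) = qnorm2 x *\<^sub>R 1"
    by (simp_all add: quat_eq_iff qnorm2_def power2_eq_square)
  then show "x \<noteq> 0 \<Longrightarrow> inverse x * x = 1" "x \<noteq> 0 \<Longrightarrow> x * inverse x = 1"
    unfolding inv by (simp_all add: qnorm2_eq_0_iff)
  show "inverse (0::quat) = 0"
    by (simp add: quat_eq_iff)
qed (rule sgn_quat_def dist_quat_def open_quat_def uniformity_quat_def divide_quat_def)+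

end

instantiation quat :: real_inner
begin

definition inner_quat_def:
  "inner x y = qRe x * qRe y + qIm1 x * qIm1 y + qIm2 x * qIm2 y + qIm3 x * qIm3 y"

instance
proof
  fix x y z :: quat and r :: real
  have sq: "inner x x = qnorm2 x"
    by (simp add: inner_quat_def qnorm2_def power2_eq_square)
  show "inner x y = inner y x"
    by (simp add: inner_quat_def mult.commute)
  show "inner (x + y) z = inner x z + inner y z"
    by (simp add: inner_quat_def algebra_simps)
  show "inner (scaleR r x) y = r * inner x y"
    by (simp add: inner_quat_def algebra_simps)
  show "0 \<le> inner x x"
    unfolding sq by (simp add: qnorm2_def)
  show "inner x x = 0 \<longleftrightarrow> x = 0"
    unfolding sq by (rule qnorm2_eq_0_iff)
  show "norm x = sqrt (inner x x)"
    unfolding sq by (rule norm_quat_def)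
qed

end

definition quat_i :: quat where "quat_i = Quat 0 1 0 0"
definition quat_j :: quat where "quat_j = Quat 0 0 1 0"
definition quat_k :: quat where "quat_k = Quat 0 0 0 1"

lemma quat_units_sel [simp]:
  "qRe quat_i = 0" "qIm1 quat_i = 1" "qIm2 quat_i = 0" "qIm3 quat_i = 0"
  "qRe quat_j = 0" "qIm1 quat_j = 0" "qIm2 quat_j = 1" "qIm3 quat_j = 0"
  "qRe quat_k = 0" "qIm1 quat_k = 0" "qIm2 quat_k = 0" "qIm3 quat_k = 1"
  by (simp_all add: quat_i_def quat_j_def quat_k_def)

lemma quat_units_mult:
  "quat_i * quat_i = -1" "quat_j * quat_j = -1" "quat_k * quat_k = -1"
  "quat_i * quat_j = quat_k" "quat_j * quat_k = quat_i" "quat_k * quat_i = quat_j"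
  "quat_j * quat_i = - quat_k" "quat_k * quat_j = - quat_i" "quat_i * quat_k = - quat_j"
  by (simp_all add: quat_eq_iff)

instantiation quat :: euclidean_space
begin

definition Basis_quat_def: "Basis = {1, quat_i, quat_j, quat_k}"

instance
proof
  fix u v x :: quat
  show "u \<in> Basis \<Longrightarrow> v \<in> Basis \<Longrightarrow> inner u v = (if u = v then 1 else 0)"
    unfolding Basis_quat_def
    by (elim insertE emptyE; hypsubst; simp add: inner_quat_def quat_eq_iff)
  show "(\<forall>u\<in>Basis. inner x u = 0) \<longleftrightarrow> x = 0"
    unfolding Basis_quat_def ball_simps inner_quat_def quat_eq_iff [of x 0] by simp
qed (simp_all add: Basis_quat_def)

end

text \<open>The cross product on the imaginary quaternions, transported from \<^typ>\<open>real^3\<close> along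
  the basis $i,j,k$; real parts of the arguments are ignored.\<close>

definition im_vec :: "quat \<Rightarrow> real^3" where
  "im_vec q = vector [qIm1 q, qIm2 q, qIm3 q]"

definition im_quat :: "real^3 \<Rightarrow> quat" where
  "im_quat v = Quat 0 (v $ 1) (v $ 2) (v $ 3)"

definition qcross :: "quat \<Rightarrow> quat \<Rightarrow> quat" where
  "qcross p q = im_quat (cross3 (im_vec p) (im_vec q))"


section \<open>Slice regular functions\<close>

definition imag_units :: "quat set" where
  "imag_units = {q. q\<^sup>2 = -1}"

definition slice_plane :: "quat \<Rightarrow> quat set" where
  "slice_plane I = span {1, I}"

definition symmetric_slice_domain :: "quat set \<Rightarrow> bool" where
  "symmetric_slice_domain \<Omega> \<longleftrightarrow>
     open \<Omega> \<and> connected \<Omega> \<and> \<Omega> \<inter> \<real> \<noteq> {} \<and>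
     (\<forall>\<alpha> \<beta> :: real. \<forall>I\<in>imag_units. of_real \<alpha> + I * of_real \<beta> \<in> \<Omega> \<longrightarrow>
        (\<forall>J\<in>imag_units. of_real \<alpha> + J * of_real \<beta> \<in> \<Omega>))"

text \<open>Functions $\Omega\to\mathbb{H}$ are total functions of which only the values on $\Omega$
  matter: all the sets of functions below are closed under changing values outside $\Omega$, and
  functions on $\Omega$ have to be compared pointwise on $\Omega$.

  Holomorphy of the restriction to a slice is real differentiability in $(\alpha,\beta)$ together
  with the Cauchy-Riemann equation (mere existence of the two partial derivatives would be too
  weak); \<^term>\<open>D (1,0)\<close> and \<^term>\<open>D (0,1)\<close> are the partial derivatives.\<close>

definition slice_regular :: "quat set \<Rightarrow> (quat \<Rightarrow> quat) set" where
  "slice_regular \<Omega> = {f. \<forall>J\<in>imag_units. \<forall>\<alpha> \<beta> :: real. of_real \<alpha> + J * of_real \<beta> \<in> \<Omega> \<longrightarrow>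
     (\<exists>D. ((\<lambda>(s, t). f (of_real s + J * of_real t)) has_derivative D) (at (\<alpha>, \<beta>)) \<and>
          (1/2) *\<^sub>R (D (1, 0) + J * D (0, 1)) = 0)}"

definition slice_preserving :: "quat set \<Rightarrow> (quat \<Rightarrow> quat) set" where
  "slice_preserving \<Omega> =
     {f \<in> slice_regular \<Omega>. \<forall>I\<in>imag_units. f ` (\<Omega> \<inter> slice_plane I) \<subseteq> slice_plane I}"

definition one_slice_preserving :: "quat set \<Rightarrow> quat \<Rightarrow> (quat \<Rightarrow> quat) set" where
  "one_slice_preserving \<Omega> J =
     {f \<in> slice_regular \<Omega>. f ` (\<Omega> \<inter> slice_plane J) \<subseteq> slice_plane J}"

text \<open>On a symmetric slice domain every slice regular function has exactly one decomposition
  $f = f_0 + f_1 i + f_2 j + f_3 k$ with slice preserving components, so the choice below is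
  unique on $\Omega$.\<close>

definition slice_decomposition ::
  "quat set \<Rightarrow> (quat \<Rightarrow> quat) \<Rightarrow>
   (quat \<Rightarrow> quat) \<times> (quat \<Rightarrow> quat) \<times> (quat \<Rightarrow> quat) \<times> (quat \<Rightarrow> quat) \<Rightarrow> bool" where
  "slice_decomposition \<Omega> f = (\<lambda>(f0, f1, f2, f3).
     f0 \<in> slice_preserving \<Omega> \<and> f1 \<in> slice_preserving \<Omega> \<and>
     f2 \<in> slice_preserving \<Omega> \<and> f3 \<in> slice_preserving \<Omega> \<and>
     (\<forall>q\<in>\<Omega>. f q = f0 q + f1 q * quat_i + f2 q * quat_j + f3 q * quat_k))"

definition slice_components ::
  "quat set \<Rightarrow> (quat \<Rightarrow> quat) \<Rightarrow>
   (quat \<Rightarrow> quat) \<times> (quat \<Rightarrow> quat) \<times> (quat \<Rightarrow> quat) \<times> (quat \<Rightarrow> quat)" where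
  "slice_components \<Omega> f = (SOME F. slice_decomposition \<Omega> f F)"

definition regular_conj :: "quat set \<Rightarrow> (quat \<Rightarrow> quat) \<Rightarrow> quat \<Rightarrow> quat" where
  "regular_conj \<Omega> f = (case slice_components \<Omega> f of (f0, f1, f2, f3) \<Rightarrow>
     (\<lambda>q. f0 q - f1 q * quat_i - f2 q * quat_j - f3 q * quat_k))"

definition star_prod :: "quat set \<Rightarrow> (quat \<Rightarrow> quat) \<Rightarrow> (quat \<Rightarrow> quat) \<Rightarrow> quat \<Rightarrow> quat" where
  "star_prod \<Omega> f g =
     (case slice_components \<Omega> f of (f0, f1, f2, f3) \<Rightarrow>
      case slice_components \<Omega> g of (g0, g1, g2, g3) \<Rightarrow>
      (\<lambda>q. f0 q * g0 q - f1 q * g1 q - f2 q * g2 q - f3 q * g3 q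
         + f0 q * (g1 q * quat_i + g2 q * quat_j + g3 q * quat_k)
         + g0 q * (f1 q * quat_i + f2 q * quat_j + f3 q * quat_k)
         + (f2 q * g3 q - f3 q * g2 q) * quat_i
         + (f3 q * g1 q - f1 q * g3 q) * quat_j
         + (f1 q * g2 q - f2 q * g1 q) * quat_k))"

end

theory Submission
  imports Defs "HOL-Complex_Analysis.Conformal_Mappings"
begin

text \<open>
  By the identity theorem on a slice, a slice regular function is determined by its values at the
  real points of \<open>\<Omega>\<close>, and being in \<open>\<S>\<^sub>J\<close> can be tested there. At real points the \<open>*\<close>-product is the
  pointwise product and the regular conjugate is the pointwise one, so the question becomes when
  \<open>h f h\<^sup>c\<close> is pointwise in the plane of \<open>M\<^sub>0\<close>. Write \<open>h = p\<^sub>0 + p\<^sub>1 I + p\<^sub>2 J + p\<^sub>3 I J\<close> and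
  \<open>f = f\<^sub>0 + f\<^sub>1 I\<close> in an orthonormal frame with \<open>M\<^sub>0 = a I + b J\<close>. The real components live in an
  integral domain, so \<open>f\<^sub>1 \<noteq> 0\<close> can be cancelled and the condition reads
  \<open>p\<^sub>1 p\<^sub>3 = p\<^sub>0 p\<^sub>2\<close> and \<open>b (p\<^sub>0\<^sup>2 + p\<^sub>1\<^sup>2 - p\<^sub>2\<^sup>2 - p\<^sub>3\<^sup>2) = 2 a (p\<^sub>1 p\<^sub>2 + p\<^sub>0 p\<^sub>3)\<close>. If \<open>b = 0\<close> these force
  \<open>p\<^sub>0 = p\<^sub>1 = 0\<close>; if \<open>b > 0\<close> they force \<open>(p\<^sub>2, p\<^sub>3) = - t (p\<^sub>1, p\<^sub>0)\<close> for a constant root \<open>t\<close> of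
  \<open>b t\<^sup>2 - 2 a t - b\<close>, that is \<open>t = (a \<plusminus> 1) / b\<close>.
\<close>

section \<open>Quaternionic algebra\<close>

definition qcnj :: "quat \<Rightarrow> quat" where
  "qcnj q = Quat (qRe q) (- qIm1 q) (- qIm2 q) (- qIm3 q)"

lemma qcnj_sel [simp]:
  "qRe (qcnj q) = qRe q" "qIm1 (qcnj q) = - qIm1 q" "qIm2 (qcnj q) = - qIm2 q" "qIm3 (qcnj q) = - qIm3 q"
  by (simp_all add: qcnj_def)

lemma inner_eq_qRe: "inner p q = qRe (p * qcnj q)"
  by (simp add: inner_quat_def)

lemma qRe_eq_inner: "qRe q = inner q 1"
  by (simp add: inner_quat_def)

lemma qcnj_mult: "qcnj (p * q) = qcnj q * qcnj p"
  by (simp add: quat_eq_iff algebra_simps)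

lemma qcnj_add: "qcnj (p + q) = qcnj p + qcnj q"
  by (simp add: quat_eq_iff)

lemma qcnj_scaleR: "qcnj (r *\<^sub>R q) = r *\<^sub>R qcnj q"
  by (simp add: quat_eq_iff)

text \<open>The imaginary components of \<open>q * q\<close> are those of \<open>q\<close> times
  \<open>2 * qRe q\<close>; a nonzero real part would force them to vanish and leave a real square
  equal to -1.\<close>

lemma imag_units_iff: "q \<in> imag_units \<longleftrightarrow> qRe q = 0 \<and> (qIm1 q)\<^sup>2 + (qIm2 q)\<^sup>2 + (qIm3 q)\<^sup>2 = 1"
proof
  assume "q \<in> imag_units"
  then have *: "(qRe q)\<^sup>2 - (qIm1 q)\<^sup>2 - (qIm2 q)\<^sup>2 - (qIm3 q)\<^sup>2 = -1"
    "qRe q = 0 \<or> qIm1 q = 0" "qRe q = 0 \<or> qIm2 q = 0" "qRe q = 0 \<or> qIm3 q = 0"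
    by (auto simp: imag_units_def quat_eq_iff power2_eq_square)
  have "qRe q = 0"
  proof (rule ccontr)
    assume "qRe q \<noteq> 0"
    with * have "(qRe q)\<^sup>2 = -1"
      by simp
    then show False
      using zero_le_power2 [of "qRe q"] by linarith
  qed
  with * show "qRe q = 0 \<and> (qIm1 q)\<^sup>2 + (qIm2 q)\<^sup>2 + (qIm3 q)\<^sup>2 = 1"
    by simp
next
  assume "qRe q = 0 \<and> (qIm1 q)\<^sup>2 + (qIm2 q)\<^sup>2 + (qIm3 q)\<^sup>2 = 1"
  then show "q \<in> imag_units"
    by (auto simp: imag_units_def quat_eq_iff power2_eq_square)
qed

lemma imag_units_iff_norm: "q \<in> imag_units \<longleftrightarrow> qRe q = 0 \<and> norm q = 1"
  by (auto simp: imag_units_iff norm_quat_def qnorm2_def)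

lemma imag_unit_square: "J \<in> imag_units \<Longrightarrow> J * J = -1"
  by (simp add: imag_units_def power2_eq_square)

lemma imag_unit_square_left: "J \<in> imag_units \<Longrightarrow> J * (J * q) = - q"
  by (simp add: imag_unit_square flip: mult.assoc)

lemma qcnj_imag_unit: "J \<in> imag_units \<Longrightarrow> qcnj J = - J"
  by (simp add: imag_units_iff quat_eq_iff)

lemma quat_i_imag_unit: "quat_i \<in> imag_units"
  by (simp add: imag_units_iff)

lemma imag_units_anticommute:
  assumes "I \<in> imag_units" "J \<in> imag_units" "inner I J = 0"
  shows "J * I = - (I * J)"
  using assms by (simp add: imag_units_iff inner_quat_def quat_eq_iff algebra_simps)

lemma imag_units_mult:
  assumes "I \<in> imag_units" "J \<in> imag_units" "inner I J = 0"
  shows "I * J \<in> imag_units" "inner I (I * J) = 0" "inner J (I * J) = 0"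
proof -
  have "qRe (I * J) = 0"
    using assms by (simp add: imag_units_iff inner_quat_def)
  then show "I * J \<in> imag_units"
    using assms by (simp add: imag_units_iff_norm norm_mult)
  show "inner I (I * J) = 0" "inner J (I * J) = 0"
    using assms by (simp_all add: imag_units_iff inner_quat_def algebra_simps)
qed

text \<open>Two vectors cannot span a space of dimension 4; a normalised vector orthogonal to both 1
  and \<open>I\<close> has real part 0 and norm 1.\<close>

lemma exists_orthogonal_imag_unit:
  obtains J where "J \<in> imag_units" "inner I J = 0"
proof -
  have "card {1, I} < DIM(quat)"
    by (rule le_less_trans [OF card_insert_le_m1 [of 2]]) (auto simp: Basis_quat_def quat_eq_iff)
  then have "dim {1, I} < DIM(quat)"
    using dim_le_card' [of "{1, I}"] by simp
  then obtain y where y: "y \<noteq> 0" "\<And>z. z \<in> span {1, I} \<Longrightarrow> orthogonal y z"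
    using orthogonal_to_subspace_exists by blast
  then have "inner y 1 = 0" "inner I y = 0"
    by (auto simp: orthogonal_def span_base inner_commute)
  then have "y /\<^sub>R norm y \<in> imag_units" "inner I (y /\<^sub>R norm y) = 0"
    using y(1) by (simp_all add: imag_units_iff_norm qRe_eq_inner)
  then show ?thesis
    by (rule that)
qed

lemma slice_plane_iff: "q \<in> slice_plane I \<longleftrightarrow> (\<exists>a b. q = of_real a + b *\<^sub>R I)"
proof
  assume "q \<in> slice_plane I"
  then obtain a where "q - a *\<^sub>R 1 \<in> span {I}"
    unfolding slice_plane_def by (auto simp: span_insert)
  then obtain b where "q - a *\<^sub>R 1 = b *\<^sub>R I"
    by (auto simp: span_singleton)
  then have "q = of_real a + b *\<^sub>R I"
    by (simp add: of_real_def algebra_simps)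
  then show "\<exists>a b. q = of_real a + b *\<^sub>R I"
    by blast
next
  assume "\<exists>a b. q = of_real a + b *\<^sub>R I"
  then show "q \<in> slice_plane I"
    unfolding slice_plane_def of_real_def
    by (auto intro!: span_add span_scale intro: span_base)
qed

lemma slice_plane_uminus: "slice_plane (- I) = slice_plane I"
proof -
  have "\<exists>b'. b *\<^sub>R (- I) = b' *\<^sub>R I" "\<exists>b'. b *\<^sub>R I = b' *\<^sub>R (- I)" for b
    by (rule exI [of _ "- b"], simp)+
  then show ?thesis
    unfolding set_eq_iff slice_plane_iff by metis
qed

text \<open>Comparing real parts removes the real summand of \<open>M\<close> as an element of the
  plane of \<open>I\<close>; comparing norms leaves a coefficient of modulus 1.\<close>

lemma slice_plane_eq_iff:
  assumes "I \<in> imag_units" "M \<in> imag_units"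
  shows "slice_plane I = slice_plane M \<longleftrightarrow> M = I \<or> M = - I"
proof
  assume "slice_plane I = slice_plane M"
  moreover have "M \<in> slice_plane M"
    by (auto simp: slice_plane_def intro: span_base)
  ultimately have "M \<in> slice_plane I"
    by simp
  then obtain a b where M: "M = of_real a + b *\<^sub>R I"
    by (auto simp: slice_plane_iff)
  then have "M = b *\<^sub>R I"
    using arg_cong [OF M, of qRe] assms by (simp add: imag_units_iff)
  moreover have "\<bar>b\<bar> = 1"
    using arg_cong [OF \<open>M = b *\<^sub>R I\<close>, of norm] assms by (simp add: imag_units_iff_norm)
  ultimately show "M = I \<or> M = - I"
    by (auto simp: abs_if split: if_splits)
qed (auto simp: slice_plane_uminus)

section \<open>Orthonormal frames as algebra automorphisms\<close>

definition rot :: "quat \<Rightarrow> quat \<Rightarrow> quat \<Rightarrow> quat" where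
  "rot I J q = qRe q *\<^sub>R 1 + qIm1 q *\<^sub>R I + qIm2 q *\<^sub>R J + qIm3 q *\<^sub>R (I * J)"

lemma linear_rot: "linear (rot I J)"
  by (rule linearI) (simp_all add: rot_def algebra_simps)

lemma rot_units [simp]:
  "rot I J 1 = 1" "rot I J quat_i = I" "rot I J quat_j = J" "rot I J quat_k = I * J"
  by (simp_all add: rot_def)

context
  fixes I J :: quat
  assumes I: "I \<in> imag_units" and J: "J \<in> imag_units" and IJ: "inner I J = 0"
begin

text \<open>From I^2 = J^2 = -1 and J I = - I J, the units I, J, I J multiply exactly like i, j, k.
  Computations in an adapted frame can therefore be done in standard coordinates.\<close>

lemma rot_mult: "rot I J (p * q) = rot I J p * rot I J q"
proof -
  note sq = imag_unit_square [OF I] imag_unit_square [OF J]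
    imag_unit_square_left [OF I] imag_unit_square_left [OF J]
  have ac: "J * I = - (I * J)" "J * (I * q) = - (I * (J * q))" for q
    using imag_units_anticommute [OF I J IJ] by (simp_all flip: mult.assoc)
  show ?thesis
    by (simp add: rot_def sq ac algebra_simps)
qed

lemma qRe_rot: "qRe (rot I J q) = qRe q"
  using I J imag_units_mult(1) [OF I J IJ] by (simp add: rot_def imag_units_iff)

lemma qcnj_rot: "qcnj (rot I J q) = rot I J (qcnj q)"
  using qcnj_imag_unit [OF I] qcnj_imag_unit [OF J]
    qcnj_imag_unit [OF imag_units_mult(1) [OF I J IJ]]
  by (simp add: rot_def qcnj_add qcnj_scaleR) (simp add: quat_eq_iff)

text \<open>The inner product is the real part of \<open>p * qcnj q\<close>, and \<open>rot\<close>
  respects products, conjugates and real parts.\<close>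

lemma inner_rot: "inner (rot I J p) (rot I J q) = inner p q"
  by (simp add: inner_eq_qRe qcnj_rot qRe_rot flip: rot_mult)

lemma inner_rot_units:
  "inner (rot I J p) 1 = qRe p" "inner (rot I J p) I = qIm1 p"
  "inner (rot I J p) J = qIm2 p" "inner (rot I J p) (I * J) = qIm3 p"
  using inner_rot [of p 1] inner_rot [of p quat_i] inner_rot [of p quat_j] inner_rot [of p quat_k]
  by (simp_all only: rot_units) (simp_all add: inner_quat_def)

lemma inj_rot: "inj (rot I J)"
  unfolding linear_injective_0 [OF linear_rot]
  using inner_rot by (metis inner_eq_zero_iff)

lemma rot_eq_iff: "rot I J p = rot I J q \<longleftrightarrow> p = q"
  using inj_rot by (simp add: inj_eq)

lemma rot_surjE: obtains p where "q = rot I J p"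
  using linear_injective_imp_surjective [OF linear_rot inj_rot] by (metis surjE)

lemma rot_mem_slice_plane: "rot I J p \<in> slice_plane I \<longleftrightarrow> qIm2 p = 0 \<and> qIm3 p = 0"
proof -
  have "rot I J p \<in> slice_plane I \<longleftrightarrow> (\<exists>a b. rot I J p = rot I J (Quat a b 0 0))"
    by (simp add: slice_plane_iff rot_def of_real_def)
  then show ?thesis
    unfolding rot_eq_iff by (auto simp: quat_eq_iff)
qed

text \<open>Turns membership in a slice plane into the vanishing of two real functionals, a
  condition the identity theorem can propagate.\<close>

lemma mem_slice_plane_iff_inner: "q \<in> slice_plane I \<longleftrightarrow> inner q J = 0 \<and> inner q (I * J) = 0"
  by (rule rot_surjE [of q]) (simp add: rot_mem_slice_plane inner_rot_units)

end

lemma quat_eq_inner: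
  "q = inner q 1 *\<^sub>R 1 + inner q quat_i *\<^sub>R quat_i + inner q quat_j *\<^sub>R quat_j + inner q quat_k *\<^sub>R quat_k"
  by (simp add: quat_eq_iff inner_quat_def)

section \<open>Slices of a symmetric domain\<close>

definition slice_pt :: "quat \<Rightarrow> complex \<Rightarrow> quat" where
  "slice_pt J z = of_real (Re z) + J * of_real (Im z)"

definition im_part :: "quat \<Rightarrow> quat" where
  "im_part q = q - of_real (qRe q)"

text \<open>Normalising the coordinate to the closed upper half plane makes it a continuous function
  of \<open>q\<close>, also at real points, which lie on every slice.\<close>

definition slice_coord :: "quat \<Rightarrow> complex" where
  "slice_coord q = Complex (qRe q) (norm (im_part q))"

text \<open>The choice of \<open>quat_i\<close> is immaterial for symmetric domains: every imaginary
  unit yields the same planar set.\<close>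

definition slice_dom :: "quat set \<Rightarrow> complex set" where
  "slice_dom \<Omega> = {z. slice_pt quat_i z \<in> \<Omega>}"

lemma slice_pt_of_real [simp]: "slice_pt J (of_real x) = of_real x"
  by (simp add: slice_pt_def)

lemma slice_pt_cnj: "slice_pt J (cnj z) = slice_pt (- J) z"
  by (simp add: slice_pt_def)

lemma uminus_imag_unit: "J \<in> imag_units \<Longrightarrow> - J \<in> imag_units"
  by (simp add: imag_units_def)

lemma continuous_on_slice_pt: "continuous_on A (slice_pt J)"
  unfolding slice_pt_def by (intro continuous_intros)

lemma continuous_on_slice_coord: "continuous_on A slice_coord"
  unfolding slice_coord_def im_part_def qRe_eq_inner Complex_eq by (intro continuous_intros)

lemma slice_coordE:
  obtains J where "J \<in> imag_units" "q = slice_pt J (slice_coord q)"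
proof (cases "im_part q = 0")
  case True
  \<comment> \<open>A real point lies on every slice, so any unit serves as
    \<open>J\<close>.\<close>
  then have "q = slice_pt quat_i (slice_coord q)"
    by (simp add: slice_pt_def slice_coord_def im_part_def)
  then show ?thesis
    using that quat_i_imag_unit by blast
next
  case False
  have "im_part q /\<^sub>R norm (im_part q) \<in> imag_units"
    using False by (simp add: imag_units_iff_norm im_part_def)
  moreover have "q = slice_pt (im_part q /\<^sub>R norm (im_part q)) (slice_coord q)"
    using False by (simp add: slice_pt_def slice_coord_def of_real_def) (simp add: im_part_def of_real_def)
  ultimately show ?thesis
    by (rule that)
qed

lemma qRe_slice_pt: "J \<in> imag_units \<Longrightarrow> qRe (slice_pt J z) = Re z"
  by (simp add: slice_pt_def imag_units_iff)

lemma im_part_slice_pt: "J \<in> imag_units \<Longrightarrow> im_part (slice_pt J z) = Im z *\<^sub>R J"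
  using qRe_slice_pt [of J z] by (simp add: im_part_def) (simp add: slice_pt_def of_real_def)

lemma slice_coord_slice_pt:
  "J \<in> imag_units \<Longrightarrow> slice_coord (slice_pt J z) = Complex (Re z) \<bar>Im z\<bar>"
  by (simp add: slice_coord_def im_part_slice_pt qRe_slice_pt imag_units_iff_norm)

lemma slice_pt_in_slice_plane: "slice_pt J z \<in> slice_plane J"
  by (auto simp: slice_pt_def slice_plane_iff of_real_def)

lemma slice_plane_slice_ptE:
  assumes "q \<in> slice_plane J"
  obtains z where "q = slice_pt J z"
proof -
  obtain a b where "q = of_real a + b *\<^sub>R J"
    using assms by (auto simp: slice_plane_iff)
  then have "q = slice_pt J (Complex a b)"
    by (simp add: slice_pt_def of_real_def)
  then show ?thesis
    by (rule that)
qed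

lemma slice_plane_commute:
  assumes "q \<in> slice_plane J"
  shows "J * q = q * J"
  using assms by (auto simp: slice_plane_iff algebra_simps of_real_def)

section \<open>The planar domain shared by all slices, and the identity theorem on it\<close>

locale slice_domain =
  fixes \<Omega> :: "quat set"
  assumes ssd: "symmetric_slice_domain \<Omega>"
begin

abbreviation D :: "complex set" where "D \<equiv> slice_dom \<Omega>"

lemma slice_pt_mem_iff:
  assumes "J \<in> imag_units"
  shows "slice_pt J z \<in> \<Omega> \<longleftrightarrow> z \<in> D"
  using ssd assms quat_i_imag_unit
  unfolding slice_dom_def slice_pt_def symmetric_slice_domain_def mem_Collect_eq by blast

text \<open>Conjugating the coordinate amounts to replacing \<open>quat_i\<close> by
  \<open>- quat_i\<close>, which the symmetry of \<Omega> permits.\<close>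

lemma cnj_mem_iff: "cnj z \<in> D \<longleftrightarrow> z \<in> D"
  using slice_pt_mem_iff [OF uminus_imag_unit [OF quat_i_imag_unit], of z]
  by (simp add: slice_pt_cnj [symmetric]) (simp add: slice_dom_def slice_pt_cnj)

lemma of_real_mem_iff: "(of_real x :: complex) \<in> D \<longleftrightarrow> of_real x \<in> \<Omega>"
  by (simp add: slice_dom_def)

lemma open_D: "open D"
proof -
  have "open (slice_pt quat_i -` \<Omega>)"
    using ssd by (intro open_vimage continuous_on_slice_pt) (simp add: symmetric_slice_domain_def)
  then show ?thesis
    by (simp add: slice_dom_def vimage_def)
qed

lemma real_pointE: obtains x :: real where "of_real x \<in> \<Omega>"
  using ssd by (auto simp: symmetric_slice_domain_def Reals_def)

lemma slice_coord_mem: "q \<in> \<Omega> \<Longrightarrow> slice_coord q \<in> D"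
  by (metis slice_coordE slice_pt_mem_iff)

text \<open>The closed upper half of \<open>D\<close> is the continuous image of \<Omega> under
  \<open>slice_coord\<close>; the lower half is its mirror image, and the two share a real
  point.\<close>

lemma connected_D: "connected D"
proof -
  let ?P = "slice_coord ` \<Omega>"
  have P: "connected ?P"
    using ssd by (intro connected_continuous_image continuous_on_slice_coord)
      (simp add: symmetric_slice_domain_def)
  have "z \<in> ?P \<union> cnj ` ?P" if "z \<in> D" for z
  proof -
    have "slice_pt quat_i z \<in> \<Omega>" "slice_coord (slice_pt quat_i z) = Complex (Re z) \<bar>Im z\<bar>"
      using that quat_i_imag_unit by (auto simp: slice_pt_mem_iff slice_coord_slice_pt)
    then have "Complex (Re z) \<bar>Im z\<bar> \<in> ?P"
      by (metis imageI)
    moreover have "z = Complex (Re z) \<bar>Im z\<bar> \<or> z = cnj (Complex (Re z) \<bar>Im z\<bar>)"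
      by (auto simp: complex_eq_iff)
    ultimately show ?thesis
      by (metis UnCI imageI)
  qed
  moreover have "?P \<union> cnj ` ?P \<subseteq> D"
    using slice_coord_mem cnj_mem_iff by auto
  ultimately have eq: "D = ?P \<union> cnj ` ?P"
    by blast
  obtain x :: real where x: "of_real x \<in> \<Omega>"
    by (rule real_pointE)
  have "slice_coord (of_real x) = of_real x"
    by (simp add: slice_coord_def im_part_def complex_eq_iff)
  then have "of_real x \<in> ?P"
    using x by (metis imageI)
  then have "of_real x \<in> ?P \<inter> cnj ` ?P"
    by (metis IntI complex_cnj_complex_of_real imageI)
  moreover have "connected (cnj ` ?P)"
    by (rule connected_continuous_image [OF _ P]) (intro continuous_intros)
  ultimately show ?thesis
    unfolding eq using P by (intro connected_Un) auto
qed

text \<open>Identity theorem: \<open>D\<close> is open and meets the real axis, so its real points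
  accumulate at each of them.\<close>

lemma holomorphic_eq_0:
  assumes "\<phi> holomorphic_on D" "\<And>x::real. of_real x \<in> \<Omega> \<Longrightarrow> \<phi> (of_real x) = 0" "z \<in> D"
  shows "\<phi> z = 0"
proof -
  obtain x :: real where x: "of_real x \<in> \<Omega>"
    by (rule real_pointE)
  have "(of_real x :: complex) islimpt D \<inter> \<real>"
  proof -
    have "(of_real x :: complex) islimpt \<real>"
    proof (rule islimptI)
      fix T :: "complex set" assume T: "of_real x \<in> T" "open T"
      then obtain e where e: "e > 0" "ball (of_real x) e \<subseteq> T"
        by (auto simp: open_contains_ball)
      have "of_real (x + e / 2) \<in> ball (of_real x :: complex) e"
        using e by (simp add: dist_norm norm_divide)
      then have "of_real (x + e / 2) \<in> T"
        using e by blast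
      then show "\<exists>y\<in>\<real>. y \<in> T \<and> y \<noteq> complex_of_real x"
        using e by (intro bexI [of _ "of_real (x + e / 2)"]) (auto simp del: of_real_add)
    qed
    then show ?thesis
      using x open_D by (metis Int_commute islimpt_Int_eventually eventually_at_in_open' of_real_mem_iff)
  qed
  moreover have "\<phi> w = 0" if "w \<in> D \<inter> \<real>" for w
    using that assms(2) by (auto simp: Reals_def of_real_mem_iff)
  ultimately show ?thesis
    using analytic_continuation [OF assms(1) open_D connected_D Int_lower1 _ _ _ assms(3)]
      of_real_mem_iff x by blast
qed

end

lemma bounded_linear_slice_pt: "bounded_linear (slice_pt J)"
  unfolding slice_pt_def of_real_def
  by (intro bounded_linear_intros bounded_linear_Re bounded_linear_Im)

lemma slice_pt_mult:
  "J \<in> imag_units \<Longrightarrow> slice_pt J (a * b) = slice_pt J a * slice_pt J b"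
  using imag_unit_square [of J] by (simp add: slice_pt_def of_real_def algebra_simps)

lemma slice_pt_commute:
  assumes "q \<in> slice_plane J"
  shows "q * slice_pt J t = slice_pt J t * q"
  using slice_plane_commute [OF assms] by (simp add: slice_pt_def of_real_def algebra_simps)

lemma inner_imag_unit_mult:
  assumes "J \<in> imag_units"
  shows "inner (J * d) w = - inner d (J * w)" "inner (J * d) (J * w) = inner d w"
proof -
  have "inner (J * a) b = - inner a (J * b)" for a b
    using assms by (simp add: inner_quat_def imag_units_iff algebra_simps)
  then show "inner (J * d) w = - inner d (J * w)" "inner (J * d) (J * w) = inner d w"
    using imag_unit_square_left [OF assms] by simp_all
qed

text \<open>The slice function induced by the stem function G = u + i v, that is, u + J v at the
  point with coordinate z on the slice of J. The unit is recovered by normalising the imaginary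
  part; at a real point this gives 0 / 0 = 0, which is harmless when Im G vanishes there.\<close>

definition stem_ext :: "(complex \<Rightarrow> complex) \<Rightarrow> quat \<Rightarrow> quat" where
  "stem_ext G q = of_real (Re (G (slice_coord q)))
     + (im_part q /\<^sub>R norm (im_part q)) * of_real (Im (G (slice_coord q)))"

text \<open>Left multiplication by \<open>J\<close> is skew-adjoint, so the Cauchy-Riemann equation of \<open>f\<close> on the
  slice of \<open>J\<close> turns into the scalar one for this function.\<close>

definition slice_func :: "(quat \<Rightarrow> quat) \<Rightarrow> quat \<Rightarrow> quat \<Rightarrow> complex \<Rightarrow> complex" where
  "slice_func f J w z = Complex (inner (f (slice_pt J z)) w) (inner (f (slice_pt J z)) (J * w))"

section \<open>Slice regular functions and their values at real points\<close>

context slice_domain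
begin

text \<open>The Cauchy-Riemann equation makes the real derivative linear over the complex plane of
  \<open>J\<close> acting from the left, so a single quaternion \<open>d\<close> determines
  it.\<close>

lemma slice_regular_iff:
  "f \<in> slice_regular \<Omega> \<longleftrightarrow> (\<forall>J\<in>imag_units. \<forall>z\<in>D. \<exists>d.
     ((\<lambda>z. f (slice_pt J z)) has_derivative (\<lambda>t. slice_pt J t * d)) (at z))"
proof
  assume f: "f \<in> slice_regular \<Omega>"
  show "\<forall>J\<in>imag_units. \<forall>z\<in>D. \<exists>d.
     ((\<lambda>z. f (slice_pt J z)) has_derivative (\<lambda>t. slice_pt J t * d)) (at z)"
  proof (intro ballI)
    fix J z assume J: "J \<in> imag_units" and z: "z \<in> D"
    have "of_real (Re z) + J * of_real (Im z) \<in> \<Omega>"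
      using J z slice_pt_mem_iff [of J z] by (simp add: slice_pt_def)
    with f J obtain T where T: "((\<lambda>(s, t). f (of_real s + J * of_real t)) has_derivative T) (at (Re z, Im z))"
      and CR: "T (1, 0) + J * T (0, 1) = 0"
      unfolding slice_regular_def by auto metis
    \<comment> \<open>\<open>d\<close> is the partial derivative in the real direction; multiplying
      the Cauchy-Riemann equation by \<open>J\<close> on the left expresses the other partial
      derivative through it.\<close>
    define d where "d = T (1, 0)"
    have "J * (T (1, 0) + J * T (0, 1)) = 0"
      using CR by simp
    then have T01: "T (0, 1) = J * d"
      using imag_unit_square_left [OF J] by (simp add: distrib_left d_def)
    have lin: "linear T"
      using T by (rule has_derivative_linear)
    have Teq: "T (s, t) = (of_real s + J * of_real t) * d" for s t
    proof -
      have "T (s, t) = T (s *\<^sub>R (1, 0) + t *\<^sub>R (0, 1))"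
        by simp
      also have "\<dots> = s *\<^sub>R T (1, 0) + t *\<^sub>R T (0, 1)"
        using lin by (simp only: linear_add linear_scale)
      finally show ?thesis
        by (simp add: T01 of_real_def algebra_simps flip: d_def)
    qed
    have "((\<lambda>z. (Re z, Im z)) has_derivative (\<lambda>z. (Re z, Im z))) (at z)"
      by (auto intro!: derivative_eq_intros)
    from has_derivative_compose [OF this T]
    have "((\<lambda>z. f (slice_pt J z)) has_derivative (\<lambda>t. slice_pt J t * d)) (at z)"
      by (simp add: slice_pt_def Teq)
    then show "\<exists>d. ((\<lambda>z. f (slice_pt J z)) has_derivative (\<lambda>t. slice_pt J t * d)) (at z)"
      by blast
  qed
next
  assume *: "\<forall>J\<in>imag_units. \<forall>z\<in>D. \<exists>d.
     ((\<lambda>z. f (slice_pt J z)) has_derivative (\<lambda>t. slice_pt J t * d)) (at z)"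
  show "f \<in> slice_regular \<Omega>"
    unfolding slice_regular_def mem_Collect_eq
  proof (intro ballI allI impI)
    fix J and \<alpha> \<beta> :: real
    assume J: "J \<in> imag_units" and "of_real \<alpha> + J * of_real \<beta> \<in> \<Omega>"
    then have "Complex \<alpha> \<beta> \<in> D"
      using slice_pt_mem_iff [of J "Complex \<alpha> \<beta>"] by (simp add: slice_pt_def)
    with * J obtain d where
      d: "((\<lambda>z. f (slice_pt J z)) has_derivative (\<lambda>t. slice_pt J t * d)) (at (Complex \<alpha> \<beta>))"
      by blast
    have "((\<lambda>p. complex_of_real (fst p) + \<i> * complex_of_real (snd p)) has_derivative
        (\<lambda>p. complex_of_real (fst p) + \<i> * complex_of_real (snd p))) (at (\<alpha>, \<beta>))"
      by (auto intro!: derivative_eq_intros)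
    from has_derivative_compose [OF this, of "\<lambda>z. f (slice_pt J z)" "\<lambda>t. slice_pt J t * d"] d
    have "((\<lambda>(s, t). f (of_real s + J * of_real t)) has_derivative
        (\<lambda>(s, t). (of_real s + J * of_real t) * d)) (at (\<alpha>, \<beta>))"
      by (simp add: slice_pt_def Complex_eq case_prod_unfold)
    moreover have "1 * d + J * (J * d) = 0"
      using imag_unit_square_left [OF J] by simp
    ultimately show "\<exists>T. ((\<lambda>(s, t). f (of_real s + J * of_real t)) has_derivative T) (at (\<alpha>, \<beta>)) \<and>
          (1/2) *\<^sub>R (T (1, 0) + J * T (0, 1)) = 0"
      by (intro exI [of _ "\<lambda>(s, t). (of_real s + J * of_real t) * d"]) simp
  qed
qed

lemma slice_regularE:
  assumes "f \<in> slice_regular \<Omega>" "J \<in> imag_units" "z \<in> D"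
  obtains d where "((\<lambda>z. f (slice_pt J z)) has_derivative (\<lambda>t. slice_pt J t * d)) (at z)"
  using assms unfolding slice_regular_iff by blast

lemma slice_func_holomorphic:
  assumes "f \<in> slice_regular \<Omega>" "J \<in> imag_units"
  shows "slice_func f J w holomorphic_on D"
proof -
  have "\<exists>c. (slice_func f J w has_field_derivative c) (at z)" if "z \<in> D" for z
  proof -
    obtain d where
      d: "((\<lambda>z. f (slice_pt J z)) has_derivative (\<lambda>t. slice_pt J t * d)) (at z)"
      by (rule slice_regularE [OF assms \<open>z \<in> D\<close>])
    have "((\<lambda>z. complex_of_real (inner (f (slice_pt J z)) w)
            + \<i> * complex_of_real (inner (f (slice_pt J z)) (J * w))) has_derivative
        (\<lambda>t. complex_of_real (inner (slice_pt J t * d) w)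
            + \<i> * complex_of_real (inner (slice_pt J t * d) (J * w)))) (at z)"
      by (auto intro!: derivative_eq_intros d)
    \<comment> \<open>The constant is the value at t = 1. At t = \<i>, moving \<open>J\<close>
      across the inner product multiplies this value by \<i>, so the map is complex linear.\<close>
    also have "(\<lambda>t. complex_of_real (inner (slice_pt J t * d) w)
            + \<i> * complex_of_real (inner (slice_pt J t * d) (J * w)))
        = (*) (Complex (inner d w) (inner d (J * w)))"
      by (rule ext) (simp add: complex_eq_iff slice_pt_def of_real_def distrib_right inner_add_left
            inner_imag_unit_mult [OF assms(2)] imag_unit_square_left [OF assms(2)] algebra_simps)
    finally show ?thesis
      unfolding slice_func_def Complex_eq has_field_derivative_def by blast
  qed
  then show ?thesis
    using open_D by (auto simp: holomorphic_on_open)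
qed

lemma slice_func_of_real:
  "slice_func f J w (of_real x) = Complex (inner (f (of_real x)) w) (inner (f (of_real x)) (J * w))"
  by (simp add: slice_func_def)

text \<open>The two inner products are the real and imaginary parts of
  \<open>slice_func f J w\<close>, which therefore vanishes at the real points and hence on all of
  \<open>D\<close>.\<close>

lemma slice_regular_inner_eq_0:
  assumes "f \<in> slice_regular \<Omega>" "J \<in> imag_units" "z \<in> D"
    and "\<And>x. of_real x \<in> \<Omega> \<Longrightarrow> inner (f (of_real x)) w = 0 \<and> inner (f (of_real x)) (J * w) = 0"
  shows "inner (f (slice_pt J z)) w = 0"
proof -
  have "slice_func f J w z = 0"
  proof (rule holomorphic_eq_0 [OF slice_func_holomorphic [OF assms(1,2)] _ assms(3)])
    show "slice_func f J w (of_real x) = 0" if "of_real x \<in> \<Omega>" for x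
      using assms(4) [OF that] by (simp add: slice_func_of_real complex_eq_iff)
  qed
  then show ?thesis
    by (simp add: slice_func_def complex_eq_iff)
qed

section \<open>Closure properties of slice regular functions and tests at real points\<close>

lemma slice_regular_const: "(\<lambda>_. c) \<in> slice_regular \<Omega>"
  unfolding slice_regular_iff by (auto intro!: exI [of _ 0])

lemma slice_regular_add:
  assumes "f \<in> slice_regular \<Omega>" "g \<in> slice_regular \<Omega>"
  shows "(\<lambda>q. f q + g q) \<in> slice_regular \<Omega>"
  unfolding slice_regular_iff
proof (intro ballI)
  fix J z assume "J \<in> imag_units" "z \<in> D"
  then obtain d e where
    "((\<lambda>z. f (slice_pt J z)) has_derivative (\<lambda>t. slice_pt J t * d)) (at z)"
    "((\<lambda>z. g (slice_pt J z)) has_derivative (\<lambda>t. slice_pt J t * e)) (at z)"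
    using assms by (metis slice_regularE)
  then have "((\<lambda>z. f (slice_pt J z) + g (slice_pt J z)) has_derivative (\<lambda>t. slice_pt J t * (d + e))) (at z)"
    by (auto intro!: derivative_eq_intros simp: distrib_left)
  then show "\<exists>d. ((\<lambda>z. f (slice_pt J z) + g (slice_pt J z)) has_derivative (\<lambda>t. slice_pt J t * d)) (at z)"
    by blast
qed

text \<open>Constants are placed on the right because the derivative carries the slice coordinate on
  the left.\<close>

lemma slice_regular_mult_const:
  assumes "f \<in> slice_regular \<Omega>"
  shows "(\<lambda>q. f q * c) \<in> slice_regular \<Omega>"
  unfolding slice_regular_iff
proof (intro ballI)
  fix J z assume "J \<in> imag_units" "z \<in> D"
  then obtain d where
    "((\<lambda>z. f (slice_pt J z)) has_derivative (\<lambda>t. slice_pt J t * d)) (at z)"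
    using assms by (metis slice_regularE)
  then have "((\<lambda>z. f (slice_pt J z) * c) has_derivative (\<lambda>t. slice_pt J t * (d * c))) (at z)"
    by (auto intro!: derivative_eq_intros simp: mult.assoc)
  then show "\<exists>d. ((\<lambda>z. f (slice_pt J z) * c) has_derivative (\<lambda>t. slice_pt J t * d)) (at z)"
    by blast
qed

lemma slice_regular_diff:
  assumes "f \<in> slice_regular \<Omega>" "g \<in> slice_regular \<Omega>"
  shows "(\<lambda>q. f q - g q) \<in> slice_regular \<Omega>"
  using slice_regular_add [OF assms(1) slice_regular_mult_const [OF assms(2), of "-1"]] by simp

lemma slice_preserving_slice_pt:
  assumes "p \<in> slice_preserving \<Omega>" "J \<in> imag_units" "z \<in> D"
  shows "p (slice_pt J z) \<in> slice_plane J"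
  using assms slice_pt_in_slice_plane [of J z] slice_pt_mem_iff
  unfolding slice_preserving_def by blast

text \<open>On the slice of \<open>J\<close> the values of \<open>p\<close> lie in the plane of
  \<open>J\<close> and commute with the coordinate, which can thus be pulled to the left in the
  product rule.\<close>

lemma slice_regular_mult:
  assumes "p \<in> slice_preserving \<Omega>" "g \<in> slice_regular \<Omega>"
  shows "(\<lambda>q. p q * g q) \<in> slice_regular \<Omega>"
  unfolding slice_regular_iff
proof (intro ballI)
  fix J z assume Jz: "J \<in> imag_units" "z \<in> D"
  have "p \<in> slice_regular \<Omega>"
    using assms by (simp add: slice_preserving_def)
  then obtain d e where de:
    "((\<lambda>z. p (slice_pt J z)) has_derivative (\<lambda>t. slice_pt J t * d)) (at z)"
    "((\<lambda>z. g (slice_pt J z)) has_derivative (\<lambda>t. slice_pt J t * e)) (at z)"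
    using assms Jz by (metis slice_regularE)
  have comm: "p (slice_pt J z) * (slice_pt J t * e) = slice_pt J t * (p (slice_pt J z) * e)" for t
    using slice_pt_commute [OF slice_preserving_slice_pt [OF assms(1) Jz]] by (metis mult.assoc)
  have "((\<lambda>z. p (slice_pt J z) * g (slice_pt J z)) has_derivative
      (\<lambda>t. slice_pt J t * (p (slice_pt J z) * e + d * g (slice_pt J z)))) (at z)"
    using has_derivative_mult [OF de] by (simp add: comm distrib_left mult.assoc)
  then show "\<exists>d. ((\<lambda>z. p (slice_pt J z) * g (slice_pt J z)) has_derivative (\<lambda>t. slice_pt J t * d)) (at z)"
    by blast
qed

lemma slice_preserving_regular: "p \<in> slice_preserving \<Omega> \<Longrightarrow> p \<in> slice_regular \<Omega>"
  by (simp add: slice_preserving_def)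

text \<open>Every point lies on some slice, and there all inner products of the difference with
  fixed vectors vanish by the identity theorem.\<close>

lemma slice_regular_cong_real:
  assumes "f \<in> slice_regular \<Omega>" "g \<in> slice_regular \<Omega>"
    and "\<And>x. of_real x \<in> \<Omega> \<Longrightarrow> f (of_real x) = g (of_real x)" "q \<in> \<Omega>"
  shows "f q = g q"
proof -
  obtain J where J: "J \<in> imag_units" and q: "q = slice_pt J (slice_coord q)"
    by (rule slice_coordE)
  have "inner (f q - g q) w = 0" for w
    using slice_regular_inner_eq_0 [OF slice_regular_diff [OF assms(1,2)] J slice_coord_mem [OF assms(4)], of w]
      assms(3) q by simp
  then show ?thesis
    by (metis inner_eq_zero_iff right_minus_eq)
qed

lemma of_real_mem_slice_plane: "of_real x \<in> slice_plane J"
  using slice_pt_in_slice_plane [of J "of_real x"] by simp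

lemma one_slice_preserving_iff:
  assumes "J \<in> imag_units"
  shows "f \<in> one_slice_preserving \<Omega> J \<longleftrightarrow>
    f \<in> slice_regular \<Omega> \<and> (\<forall>x. of_real x \<in> \<Omega> \<longrightarrow> f (of_real x) \<in> slice_plane J)"
proof (intro iffI conjI allI impI)
  fix x assume "f \<in> one_slice_preserving \<Omega> J" "of_real x \<in> \<Omega>"
  then show "f (of_real x) \<in> slice_plane J"
    using of_real_mem_slice_plane unfolding one_slice_preserving_def by blast
next
  assume f: "f \<in> slice_regular \<Omega> \<and> (\<forall>x. of_real x \<in> \<Omega> \<longrightarrow> f (of_real x) \<in> slice_plane J)"
  obtain K where K: "K \<in> imag_units" "inner J K = 0"
    by (rule exists_orthogonal_imag_unit)
  note pl = mem_slice_plane_iff_inner [OF assms K]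
  have "f q \<in> slice_plane J" if "q \<in> \<Omega>" "q \<in> slice_plane J" for q
  proof -
    obtain z where z: "q = slice_pt J z"
      using \<open>q \<in> slice_plane J\<close> by (rule slice_plane_slice_ptE)
    have "z \<in> D"
      using that z assms slice_pt_mem_iff by blast
    \<comment> \<open>Up to sign, left multiplication by \<open>J\<close> interchanges
      \<open>K\<close> and \<open>J * K\<close>, so both inner products demanded by the identity
      principle vanish at real points for either choice of \<open>w\<close>.\<close>
    then have "inner (f (slice_pt J z)) w = 0" if "w = K \<or> w = J * K" for w
      using f that assms imag_unit_square_left [OF assms]
      by (intro slice_regular_inner_eq_0) (auto simp: pl)
    then show ?thesis
      by (simp add: pl z)
  qed
  then show "f \<in> one_slice_preserving \<Omega> J"
    using f by (auto simp: one_slice_preserving_def)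
qed (auto simp: one_slice_preserving_def)

text \<open>The slice planes of i and j already intersect in the real line, so lying in every slice
  plane means being real.\<close>

lemma slice_preserving_iff:
  "f \<in> slice_preserving \<Omega> \<longleftrightarrow>
    f \<in> slice_regular \<Omega> \<and> (\<forall>x. of_real x \<in> \<Omega> \<longrightarrow> f (of_real x) \<in> \<real>)"
proof -
  have "(\<forall>J\<in>imag_units. q \<in> slice_plane J) \<longleftrightarrow> q \<in> \<real>" for q
  proof
    assume "\<forall>J\<in>imag_units. q \<in> slice_plane J"
    then have "q \<in> slice_plane quat_i" "q \<in> slice_plane quat_j"
      by (auto simp: imag_units_iff)
    then have "qIm1 q = 0" "qIm2 q = 0" "qIm3 q = 0"
      by (auto simp: slice_plane_iff quat_eq_iff)
    then have "q = of_real (qRe q)"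
      by (simp add: quat_eq_iff)
    then show "q \<in> \<real>"
      by (metis Reals_of_real)
  qed (auto simp: Reals_def of_real_mem_slice_plane)
  moreover have "f \<in> slice_preserving \<Omega> \<longleftrightarrow> (\<forall>J\<in>imag_units. f \<in> one_slice_preserving \<Omega> J)"
    using quat_i_imag_unit by (auto simp: slice_preserving_def one_slice_preserving_def)
  moreover have "\<dots> \<longleftrightarrow> f \<in> slice_regular \<Omega> \<and>
      (\<forall>x. of_real x \<in> \<Omega> \<longrightarrow> (\<forall>J\<in>imag_units. f (of_real x) \<in> slice_plane J))"
    using quat_i_imag_unit by (auto simp: one_slice_preserving_iff)
  ultimately show ?thesis
    by simp
qed

section \<open>Stem functions and the slice preserving components\<close>

lemma stem_ext_slice_pt:
  assumes "\<And>z. z \<in> D \<Longrightarrow> G (cnj z) = cnj (G z)" "J \<in> imag_units" "z \<in> D"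
  shows "stem_ext G (slice_pt J z) = slice_pt J (G z)"
proof -
  consider "Im z > 0" | "Im z = 0" | "Im z < 0"
    by linarith
  then show ?thesis
  proof cases
    case 1
    then have "slice_coord (slice_pt J z) = z"
      using assms by (simp add: slice_coord_slice_pt complex_eq_iff)
    with 1 assms show ?thesis
      by (simp add: stem_ext_def im_part_slice_pt imag_units_iff_norm) (simp add: slice_pt_def)
  next
    case 2
    then have "slice_coord (slice_pt J z) = z" "cnj z = z"
      using assms by (simp_all add: slice_coord_slice_pt complex_eq_iff)
    \<comment> \<open>On the real axis the symmetry forces \<open>G z\<close> to be real, so the
      degenerate unit in \<open>stem_ext\<close> is multiplied by 0.\<close>
    moreover have "G z = cnj (G z)"
      using assms \<open>cnj z = z\<close> by metis
    then have "Im (G z) = 0"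
      by (simp add: complex_eq_iff)
    ultimately show ?thesis
      by (simp add: stem_ext_def slice_pt_def)
  next
    case 3
    \<comment> \<open>Here \<open>stem_ext\<close> recovers the unit \<open>- J\<close> and
      evaluates \<open>G\<close> at \<open>cnj z\<close>; by symmetry of \<open>G\<close> the two
      sign changes cancel.\<close>
    then have "slice_coord (slice_pt J z) = cnj z"
      using assms by (simp add: slice_coord_slice_pt complex_eq_iff)
    with 3 assms show ?thesis
      by (simp add: stem_ext_def im_part_slice_pt imag_units_iff_norm) (simp add: slice_pt_def)
  qed
qed

text \<open>On each slice the function is \<open>G\<close> read through \<open>slice_pt J\<close>,
  which turns multiplication by the complex derivative into multiplication inside the plane of
  \<open>J\<close>.\<close>

lemma stem_ext_slice_preserving:
  assumes "G holomorphic_on D" "\<And>z. z \<in> D \<Longrightarrow> G (cnj z) = cnj (G z)"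
  shows "stem_ext G \<in> slice_preserving \<Omega>"
proof -
  note eq = stem_ext_slice_pt [of G, OF assms(2)]
  have "\<exists>d. ((\<lambda>z. stem_ext G (slice_pt J z)) has_derivative (\<lambda>t. slice_pt J t * d)) (at z)"
    if J: "J \<in> imag_units" and z: "z \<in> D" for J z
  proof -
    obtain c where c: "(G has_derivative (*) c) (at z)"
      using assms(1) open_D z by (auto simp: holomorphic_on_open has_field_derivative_def)
    have "((\<lambda>z. slice_pt J (G z)) has_derivative (\<lambda>t. slice_pt J (c * t))) (at z)"
      by (rule bounded_linear.has_derivative [OF bounded_linear_slice_pt c])
    then have "((\<lambda>z. stem_ext G (slice_pt J z)) has_derivative (\<lambda>t. slice_pt J (c * t))) (at z)"
      using open_D z by (rule has_derivative_transform_within_open) (simp add: eq J)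
    then have "((\<lambda>z. stem_ext G (slice_pt J z)) has_derivative (\<lambda>t. slice_pt J t * slice_pt J c)) (at z)"
      using J by (simp add: slice_pt_mult mult.commute flip: slice_pt_mult)
    then show ?thesis
      by blast
  qed
  moreover have "stem_ext G (of_real x) \<in> \<real>" for x
    by (simp add: stem_ext_def im_part_def)
  ultimately show ?thesis
    by (simp add: slice_preserving_iff slice_regular_iff)
qed

text \<open>The holomorphic function \<phi> has the desired real part at real points. Averaging it
  with its Schwarz reflection cancels the imaginary part there and gives the symmetry that a stem
  function requires.\<close>

lemma real_inner_extension:
  assumes "f \<in> slice_regular \<Omega>"
  obtains p where "p \<in> slice_preserving \<Omega>"
    "\<And>x. of_real x \<in> \<Omega> \<Longrightarrow> p (of_real x) = of_real (inner (f (of_real x)) w)"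
proof -
  define \<phi> where "\<phi> = slice_func f quat_i w"
  define G where "G = (\<lambda>z. (\<phi> z + cnj (\<phi> (cnj z))) / 2)"
  have hol: "\<phi> holomorphic_on D"
    unfolding \<phi>_def using assms quat_i_imag_unit by (rule slice_func_holomorphic)
  have "cnj ` D = D"
    by (auto simp: image_cnj_conv_vimage_cnj cnj_mem_iff)
  then have "(cnj \<circ> \<phi> \<circ> cnj) holomorphic_on D"
    using holomorphic_on_compose_cnj_cnj [of \<phi> D] hol open_D by (simp add: o_def)
  then have "G holomorphic_on D"
    unfolding G_def using hol by (intro holomorphic_intros) (simp_all add: o_def)
  moreover have "G (cnj z) = cnj (G z)" for z
    by (simp add: G_def)
  ultimately have "stem_ext G \<in> slice_preserving \<Omega>" and
    ext: "\<And>z. z \<in> D \<Longrightarrow> stem_ext G (slice_pt quat_i z) = slice_pt quat_i (G z)"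
    by (auto intro!: stem_ext_slice_preserving stem_ext_slice_pt quat_i_imag_unit)
  moreover have "stem_ext G (of_real x) = of_real (inner (f (of_real x)) w)" if "of_real x \<in> \<Omega>" for x
  proof -
    have "G (of_real x) = of_real (inner (f (of_real x)) w)"
      by (simp add: G_def \<phi>_def slice_func_of_real complex_eq_iff)
    then show ?thesis
      using ext [of "of_real x"] that by (simp add: of_real_mem_iff)
  qed
  ultimately show ?thesis
    using that by blast
qed

text \<open>The components extend the four real coordinates of \<open>f\<close> at real points;
  their combination agrees with \<open>f\<close> there, hence on all of \<Omega>.\<close>

lemma slice_decomposition_exists:
  assumes "f \<in> slice_regular \<Omega>"
  shows "\<exists>F. slice_decomposition \<Omega> f F"
proof -
  have "\<forall>w. \<exists>p. p \<in> slice_preserving \<Omega> \<and>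
      (\<forall>x. of_real x \<in> \<Omega> \<longrightarrow> p (of_real x) = of_real (inner (f (of_real x)) w))"
    using real_inner_extension [OF assms] by blast
  then obtain p where p: "\<And>w. p w \<in> slice_preserving \<Omega>"
    "\<And>w x. of_real x \<in> \<Omega> \<Longrightarrow> p w (of_real x) = of_real (inner (f (of_real x)) w)"
    by metis
  have "f q = p 1 q + p quat_i q * quat_i + p quat_j q * quat_j + p quat_k q * quat_k"
    if "q \<in> \<Omega>" for q
  proof (rule slice_regular_cong_real [OF assms _ _ that])
    show "(\<lambda>q. p 1 q + p quat_i q * quat_i + p quat_j q * quat_j + p quat_k q * quat_k)
        \<in> slice_regular \<Omega>"
      by (intro slice_regular_add slice_regular_mult_const slice_preserving_regular p)
    show "f (of_real x) = p 1 (of_real x) + p quat_i (of_real x) * quat_i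
        + p quat_j (of_real x) * quat_j + p quat_k (of_real x) * quat_k" if "of_real x \<in> \<Omega>" for x
      by (subst quat_eq_inner [of "f (of_real x)"]) (simp add: p(2) [OF that] scaleR_conv_of_real)
  qed
  then have "slice_decomposition \<Omega> f (p 1, p quat_i, p quat_j, p quat_k)"
    by (simp add: slice_decomposition_def p(1))
  then show ?thesis
    by blast
qed

lemma slice_componentsE:
  assumes "f \<in> slice_regular \<Omega>"
  obtains f0 f1 f2 f3 where "slice_components \<Omega> f = (f0, f1, f2, f3)"
    "f0 \<in> slice_preserving \<Omega>" "f1 \<in> slice_preserving \<Omega>"
    "f2 \<in> slice_preserving \<Omega>" "f3 \<in> slice_preserving \<Omega>"
    "\<And>q. q \<in> \<Omega> \<Longrightarrow> f q = f0 q + f1 q * quat_i + f2 q * quat_j + f3 q * quat_k"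
proof -
  obtain f0 f1 f2 f3 where eq: "slice_components \<Omega> f = (f0, f1, f2, f3)"
    by (rule prod_cases4)
  have "slice_decomposition \<Omega> f (slice_components \<Omega> f)"
    unfolding slice_components_def using slice_decomposition_exists [OF assms] by (rule someI_ex)
  then show ?thesis
    using that [OF eq] by (simp add: eq slice_decomposition_def)
qed

section \<open>Regular conjugate and star product at real points\<close>

lemma slice_preserving_of_realE:
  assumes "p \<in> slice_preserving \<Omega>" "of_real x \<in> \<Omega>"
  obtains r where "p (of_real x) = of_real r"
  using assms by (auto simp: slice_preserving_iff Reals_def)

lemma regular_conj_regular:
  assumes "f \<in> slice_regular \<Omega>"
  shows "regular_conj \<Omega> f \<in> slice_regular \<Omega>"
  by (rule slice_componentsE [OF assms], simp add: regular_conj_def,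
      intro slice_regular_diff slice_regular_mult_const slice_preserving_regular)

lemma regular_conj_of_real:
  assumes "f \<in> slice_regular \<Omega>" "of_real x \<in> \<Omega>"
  shows "regular_conj \<Omega> f (of_real x) = qcnj (f (of_real x))"
proof -
  obtain f0 f1 f2 f3 where f: "slice_components \<Omega> f = (f0, f1, f2, f3)"
    "f0 \<in> slice_preserving \<Omega>" "f1 \<in> slice_preserving \<Omega>"
    "f2 \<in> slice_preserving \<Omega>" "f3 \<in> slice_preserving \<Omega>"
    "\<And>q. q \<in> \<Omega> \<Longrightarrow> f q = f0 q + f1 q * quat_i + f2 q * quat_j + f3 q * quat_k"
    by (rule slice_componentsE [OF assms(1)]) (rule that)
  obtain a b c d where "f0 (of_real x) = of_real a" "f1 (of_real x) = of_real b"
    "f2 (of_real x) = of_real c" "f3 (of_real x) = of_real d"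
    using f(2-5) assms(2) by (metis slice_preserving_of_realE)
  then show ?thesis
    using f(1) f(6) [OF assms(2)] by (simp add: regular_conj_def quat_eq_iff)
qed

lemma star_prod_regular:
  assumes "f \<in> slice_regular \<Omega>" "g \<in> slice_regular \<Omega>"
  shows "star_prod \<Omega> f g \<in> slice_regular \<Omega>"
  by (rule slice_componentsE [OF assms(1)], rule slice_componentsE [OF assms(2)],
      simp add: star_prod_def,
      intro slice_regular_diff slice_regular_add slice_regular_mult_const slice_regular_mult
        slice_preserving_regular)

text \<open>At a real point all eight components are real, and the defining formula becomes
  quaternion multiplication in the basis 1, i, j, k.\<close>

lemma star_prod_of_real:
  assumes "f \<in> slice_regular \<Omega>" "g \<in> slice_regular \<Omega>" "of_real x \<in> \<Omega>"
  shows "star_prod \<Omega> f g (of_real x) = f (of_real x) * g (of_real x)"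
proof -
  obtain f0 f1 f2 f3 where f: "slice_components \<Omega> f = (f0, f1, f2, f3)"
    "f0 \<in> slice_preserving \<Omega>" "f1 \<in> slice_preserving \<Omega>"
    "f2 \<in> slice_preserving \<Omega>" "f3 \<in> slice_preserving \<Omega>"
    "\<And>q. q \<in> \<Omega> \<Longrightarrow> f q = f0 q + f1 q * quat_i + f2 q * quat_j + f3 q * quat_k"
    by (rule slice_componentsE [OF assms(1)]) (rule that)
  obtain g0 g1 g2 g3 where g: "slice_components \<Omega> g = (g0, g1, g2, g3)"
    "g0 \<in> slice_preserving \<Omega>" "g1 \<in> slice_preserving \<Omega>"
    "g2 \<in> slice_preserving \<Omega>" "g3 \<in> slice_preserving \<Omega>"
    "\<And>q. q \<in> \<Omega> \<Longrightarrow> g q = g0 q + g1 q * quat_i + g2 q * quat_j + g3 q * quat_k"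
    by (rule slice_componentsE [OF assms(2)]) (rule that)
  obtain a b c d where "f0 (of_real x) = of_real a" "f1 (of_real x) = of_real b"
    "f2 (of_real x) = of_real c" "f3 (of_real x) = of_real d"
    using f(2-5) assms(3) by (metis slice_preserving_of_realE)
  moreover obtain a' b' c' d' where "g0 (of_real x) = of_real a'" "g1 (of_real x) = of_real b'"
    "g2 (of_real x) = of_real c'" "g3 (of_real x) = of_real d'"
    using g(2-5) assms(3) by (metis slice_preserving_of_realE)
  ultimately show ?thesis
    using f(1) f(6) [OF assms(3)] g(1) g(6) [OF assms(3)]
    by (simp add: star_prod_def quat_eq_iff algebra_simps)
qed

section \<open>Real traces of slice preserving functions: real-valued stand-ins forming an integral
  domain at the real points\<close>

definition real_traces :: "(real \<Rightarrow> real) set" where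
  "real_traces = {u. \<exists>p\<in>slice_preserving \<Omega>. \<forall>x. of_real x \<in> \<Omega> \<longrightarrow> p (of_real x) = of_real (u x)}"

lemma real_traces_inner:
  assumes "f \<in> slice_regular \<Omega>"
  shows "(\<lambda>x. inner (f (of_real x)) w) \<in> real_traces"
  using real_inner_extension [OF assms, of w] unfolding real_traces_def by blast

lemma real_traces_add:
  assumes "u \<in> real_traces" "v \<in> real_traces"
  shows "(\<lambda>x. u x + v x) \<in> real_traces"
proof -
  obtain p q where pq: "p \<in> slice_preserving \<Omega>" "\<And>x. of_real x \<in> \<Omega> \<Longrightarrow> p (of_real x) = of_real (u x)"
    "q \<in> slice_preserving \<Omega>" "\<And>x. of_real x \<in> \<Omega> \<Longrightarrow> q (of_real x) = of_real (v x)"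
    using assms unfolding real_traces_def by blast
  then have "(\<lambda>y. p y + q y) \<in> slice_preserving \<Omega>"
    by (auto simp: slice_preserving_iff intro!: slice_regular_add)
  then show ?thesis
    unfolding real_traces_def using pq by (auto intro!: bexI [of _ "\<lambda>y. p y + q y"])
qed

lemma real_traces_mult:
  assumes "u \<in> real_traces" "v \<in> real_traces"
  shows "(\<lambda>x. u x * v x) \<in> real_traces"
proof -
  obtain p q where pq: "p \<in> slice_preserving \<Omega>" "\<And>x. of_real x \<in> \<Omega> \<Longrightarrow> p (of_real x) = of_real (u x)"
    "q \<in> slice_preserving \<Omega>" "\<And>x. of_real x \<in> \<Omega> \<Longrightarrow> q (of_real x) = of_real (v x)"
    using assms unfolding real_traces_def by blast
  have "(\<lambda>y. p y * q y) \<in> slice_regular \<Omega>"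
    using pq by (intro slice_regular_mult slice_preserving_regular)
  then have "(\<lambda>y. p y * q y) \<in> slice_preserving \<Omega>"
    using pq by (auto simp: slice_preserving_iff)
  then show ?thesis
    unfolding real_traces_def using pq by (auto intro!: bexI [of _ "\<lambda>y. p y * q y"])
qed

lemma real_traces_const: "(\<lambda>_. c) \<in> real_traces"
  unfolding real_traces_def
  by (auto intro!: bexI [of _ "\<lambda>_. of_real c"] simp: slice_preserving_iff slice_regular_const)

text \<open>Both traces extend to holomorphic functions on the connected set \<open>D\<close>, and
  the product of the extensions is zero. If the first is nonzero somewhere, the second vanishes on
  the nonempty open set where the first does not, hence everywhere.\<close>

lemma real_traces_integral:
  assumes "u \<in> real_traces" "v \<in> real_traces"
    and uv: "\<And>x. of_real x \<in> \<Omega> \<Longrightarrow> u x * v x = 0"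
  shows "(\<forall>x. of_real x \<in> \<Omega> \<longrightarrow> u x = 0) \<or> (\<forall>x. of_real x \<in> \<Omega> \<longrightarrow> v x = 0)"
proof -
  have ext: "\<exists>G. G holomorphic_on D \<and> (\<forall>x. of_real x \<in> \<Omega> \<longrightarrow> G (of_real x) = of_real (w x))"
    if w: "w \<in> real_traces" for w
  proof -
    obtain p where p: "p \<in> slice_preserving \<Omega>" "\<And>x. of_real x \<in> \<Omega> \<Longrightarrow> p (of_real x) = of_real (w x)"
      using w unfolding real_traces_def by blast
    then have "slice_func p quat_i 1 holomorphic_on D"
      by (intro slice_func_holomorphic slice_preserving_regular quat_i_imag_unit)
    moreover have "slice_func p quat_i 1 (of_real x) = of_real (w x)" if "of_real x \<in> \<Omega>" for x
      using p(2) [OF that] by (simp add: slice_func_of_real complex_eq_iff inner_quat_def)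
    ultimately show ?thesis
      by blast
  qed
  obtain G where G: "G holomorphic_on D" "\<And>x. of_real x \<in> \<Omega> \<Longrightarrow> G (of_real x) = of_real (u x)"
    using ext [OF assms(1)] by blast
  obtain H where H: "H holomorphic_on D" "\<And>x. of_real x \<in> \<Omega> \<Longrightarrow> H (of_real x) = of_real (v x)"
    using ext [OF assms(2)] by blast
  have GH: "G z * H z = 0" if "z \<in> D" for z
  proof (rule holomorphic_eq_0 [OF _ _ that])
    show "(\<lambda>z. G z * H z) holomorphic_on D"
      using G(1) H(1) by (rule holomorphic_on_mult)
    show "G (of_real x) * H (of_real x) = 0" if "of_real x \<in> \<Omega>" for x
      using uv [OF that] by (simp add: G(2) H(2) that flip: of_real_mult)
  qed
  show ?thesis
  proof (cases "\<forall>x. of_real x \<in> \<Omega> \<longrightarrow> u x = 0")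
    case False
    then obtain x where x: "of_real x \<in> \<Omega>" "u x \<noteq> 0"
      by blast
    let ?S = "D \<inter> G -` (- {0})"
    have S: "open ?S"
      using continuous_open_preimage [OF holomorphic_on_imp_continuous_on [OF G(1)] open_D, of "- {0}"]
      by (simp add: open_Compl)
    have "of_real x \<in> ?S"
      using x G(2) by (simp add: of_real_mem_iff)
    then have "?S \<noteq> {}"
      by blast
    have "H z = 0" if "z \<in> D" for z
    proof (rule analytic_continuation_open [OF S open_D \<open>?S \<noteq> {}\<close> connected_D Int_lower1 H(1)
          holomorphic_on_const _ that])
      show "H w = 0" if "w \<in> ?S" for w
        using that GH [of w] by simp
    qed
    then show ?thesis
      using H(2) of_real_mem_iff by (metis of_real_eq_0_iff)
  qed blast
qed

end

section \<open>The conjugation equation\<close>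

lemma qcross_imag_units:
  assumes "I \<in> imag_units" "M \<in> imag_units"
  shows "qcross I M = I * M + of_real (inner I M)"
  using assms
  by (simp add: imag_units_iff qcross_def im_quat_def im_vec_def cross3_def vector_3 inner_quat_def quat_eq_iff)

text \<open>The inner product and the norm \<open>b\<close> of the cross product are the cosine and
  sine of the angle between \<open>I\<close> and \<open>M\<close>. Were the cross product zero,
  \<open>M\<close> would be plus or minus \<open>I\<close> and the planes would coincide.\<close>

lemma orthonormal_frame:
  fixes I M :: quat
  defines "K \<equiv> qcross I M /\<^sub>R norm (qcross I M)"
  assumes I: "I \<in> imag_units" and M: "M \<in> imag_units" and "slice_plane I \<noteq> slice_plane M"
  obtains b where "b > 0" "K \<in> imag_units" "inner I K = 0"
    "M = inner I M *\<^sub>R I + b *\<^sub>R (K * I)" "(inner I M)\<^sup>2 + b\<^sup>2 = 1"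
proof -
  define a where "a = inner I M"
  define C where "C = qcross I M"
  define b where "b = norm C"
  have C: "C = I * M + of_real a"
    unfolding C_def a_def by (rule qcross_imag_units [OF I M])
  have "C \<noteq> 0"
  proof
    assume "C = 0"
    with C have "I * (I * M) = I * of_real (- a)"
      by (simp add: add_eq_0_iff2)
    then have "M = a *\<^sub>R I"
      using I by (simp add: imag_unit_square_left of_real_def)
    moreover have "norm I = 1" "norm M = 1"
      using I M by (simp_all add: imag_units_iff_norm)
    ultimately have "\<bar>a\<bar> = 1"
      by simp
    then have "M = I \<or> M = - I"
      using \<open>M = a *\<^sub>R I\<close> by (auto simp: abs_if split: if_splits)
    then show False
      using assms by (simp add: slice_plane_eq_iff)
  qed
  then have "b > 0"
    by (simp add: b_def)
  have bK: "C = b *\<^sub>R K"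
    using \<open>b > 0\<close> by (simp add: K_def b_def C_def)
  have re: "inner C 1 = 0" "inner I C = 0"
    using I M by (simp_all add: C a_def imag_units_iff inner_quat_def algebra_simps)
  have normK: "norm K = 1"
    using \<open>C \<noteq> 0\<close> by (simp add: K_def C_def)
  have K: "K \<in> imag_units" "inner I K = 0"
    using re \<open>b > 0\<close> bK normK by (simp_all add: imag_units_iff_norm qRe_eq_inner)
  \<comment> \<open>Left multiplication by \<open>I\<close> solves I M = b K - a for
    \<open>M\<close>.\<close>
  have "I * (I * M) = I * (b *\<^sub>R K - of_real a)"
    using C bK by (simp add: algebra_simps)
  then have "M = a *\<^sub>R I - b *\<^sub>R (I * K)"
    using I by (simp add: imag_unit_square_left of_real_def algebra_simps)
  then have eq: "M = a *\<^sub>R I + b *\<^sub>R (K * I)"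
    using imag_units_anticommute [OF I K] by simp
  \<comment> \<open>\<open>I * M\<close> is \<open>C\<close> minus the real number \<open>a\<close>,
    and \<open>C\<close> is orthogonal to 1; its squared norm is thus both 1 and a^2 + b^2.\<close>
  have "norm (I * M) = 1"
    using I M by (simp add: imag_units_iff_norm norm_mult)
  then have "inner (C - of_real a) (C - of_real a) = 1"
    by (simp add: C dot_square_norm)
  then have "a\<^sup>2 + b\<^sup>2 = 1"
    using re(1) by (simp add: inner_diff inner_commute of_real_def b_def power2_norm_eq_inner)
      (simp add: power2_eq_square inner_quat_def)
  then show ?thesis
    using that [OF \<open>b > 0\<close> K] eq unfolding a_def by blast
qed

text \<open>An element of the plane has frame coordinates (r, t a, t b, 0); eliminating
  \<open>r\<close> and \<open>t\<close> leaves these two equations.\<close>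

lemma rot_mem_slice_plane_comb:
  assumes "I \<in> imag_units" "J \<in> imag_units" "inner I J = 0"
    and "rot I J p \<in> slice_plane (a *\<^sub>R I + b *\<^sub>R J)"
  shows "qIm3 p = 0" "b * qIm1 p = a * qIm2 p"
proof -
  obtain r t where "rot I J p = of_real r + t *\<^sub>R (a *\<^sub>R I + b *\<^sub>R J)"
    using assms(4) by (auto simp: slice_plane_iff)
  also have "\<dots> = rot I J (Quat r (t * a) (t * b) 0)"
    by (simp add: rot_def of_real_def algebra_simps)
  finally have "p = Quat r (t * a) (t * b) 0"
    by (simp add: rot_eq_iff [OF assms(1-3)])
  then show "qIm3 p = 0" "b * qIm1 p = a * qIm2 p"
    by simp_all
qed

section \<open>Solving the conjugation condition at real points\<close>

context slice_domain
begin

lemma real_traces_diff: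
  assumes "u \<in> real_traces" "v \<in> real_traces"
  shows "(\<lambda>x. u x - v x) \<in> real_traces"
  using real_traces_add [OF assms(1) real_traces_mult [OF real_traces_const [of "-1"] assms(2)]] by simp

lemmas real_traces_intros = real_traces_add real_traces_diff real_traces_mult real_traces_const

lemma star_conj_mem_iff:
  assumes "h \<in> slice_regular \<Omega>" "f \<in> slice_regular \<Omega>" "M \<in> imag_units"
  shows "star_prod \<Omega> (star_prod \<Omega> h f) (regular_conj \<Omega> h) \<in> one_slice_preserving \<Omega> M \<longleftrightarrow>
    (\<forall>x. of_real x \<in> \<Omega> \<longrightarrow> h (of_real x) * f (of_real x) * qcnj (h (of_real x)) \<in> slice_plane M)"
  using assms
  by (simp add: one_slice_preserving_iff star_prod_regular regular_conj_regular star_prod_of_real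
      regular_conj_of_real)

text \<open>The second factor must be \<open>inverse c\<close> star \<open>h\<close>. It is not zero
  because \<open>h\<close> takes a value outside the plane of \<open>I\<close> at some real point;
  the remaining claims are checked at real points.\<close>

lemma star_const_factorization:
  assumes h: "h \<in> slice_regular \<Omega> - one_slice_preserving \<Omega> I" and I: "I \<in> imag_units"
    and "c \<noteq> 0"
    and c: "\<And>x. of_real x \<in> \<Omega> \<Longrightarrow> \<exists>p\<in>slice_plane I. h (of_real x) = c * p"
  shows "\<exists>g\<in>one_slice_preserving \<Omega> I. (\<exists>q\<in>\<Omega>. g q \<noteq> 0) \<and> (\<forall>q\<in>\<Omega>. h q = star_prod \<Omega> (\<lambda>_. c) g q)"
proof -
  have hr: "h \<in> slice_regular \<Omega>"
    using h by simp
  define g where "g = star_prod \<Omega> (\<lambda>_. inverse c) h"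
  have gr: "g \<in> slice_regular \<Omega>"
    unfolding g_def by (intro star_prod_regular slice_regular_const hr)
  have g: "g (of_real x) = inverse c * h (of_real x)" if "of_real x \<in> \<Omega>" for x
    unfolding g_def by (rule star_prod_of_real [OF slice_regular_const hr that])
  have "g (of_real x) \<in> slice_plane I" if "of_real x \<in> \<Omega>" for x
    using c [OF that] \<open>c \<noteq> 0\<close> by (auto simp: g [OF that] simp flip: mult.assoc)
  then have "g \<in> one_slice_preserving \<Omega> I"
    using gr by (simp add: one_slice_preserving_iff I)
  moreover have "\<exists>q\<in>\<Omega>. g q \<noteq> 0"
  proof -
    obtain x where x: "of_real x \<in> \<Omega>" "h (of_real x) \<notin> slice_plane I"
      using h I by (auto simp: one_slice_preserving_iff)
    then have "h (of_real x) \<noteq> 0"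
      using of_real_mem_slice_plane [of 0 I] by auto
    then show ?thesis
      using x g \<open>c \<noteq> 0\<close> by (intro bexI [of _ "of_real x"]) auto
  qed
  moreover have "h q = star_prod \<Omega> (\<lambda>_. c) g q" if "q \<in> \<Omega>" for q
  proof (rule slice_regular_cong_real [OF hr star_prod_regular [OF slice_regular_const gr] _ that])
    show "h (of_real x) = star_prod \<Omega> (\<lambda>_. c) g (of_real x)" if "of_real x \<in> \<Omega>" for x
      using \<open>c \<noteq> 0\<close> by (simp add: star_prod_of_real [OF slice_regular_const gr that] g [OF that] flip: mult.assoc)
  qed
  ultimately show ?thesis
    by blast
qed

text \<open>Conjugating f0 + f1 I by h multiplies f1 by the quadratic rotation formula for the image
  of I. Membership in the plane gives both equations with an extra factor f1, which cancels in the
  integral domain of traces.\<close>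

lemma conj_equations:
  fixes I J :: quat
  defines "p0 \<equiv> \<lambda>h x. inner (h (of_real x)) 1" and "p1 \<equiv> \<lambda>h x. inner (h (of_real x)) I"
    and "p2 \<equiv> \<lambda>h x. inner (h (of_real x)) J" and "p3 \<equiv> \<lambda>h x. inner (h (of_real x)) (I * J)"
  assumes I: "I \<in> imag_units" and J: "J \<in> imag_units" and IJ: "inner I J = 0"
    and f: "f \<in> one_slice_preserving \<Omega> I - slice_preserving \<Omega>"
    and h: "h \<in> slice_regular \<Omega>"
    and mem: "\<And>x. of_real x \<in> \<Omega> \<Longrightarrow>
      h (of_real x) * f (of_real x) * qcnj (h (of_real x)) \<in> slice_plane (a *\<^sub>R I + b *\<^sub>R J)"
    and x: "of_real x \<in> \<Omega>"
  shows "p1 h x * p3 h x = p0 h x * p2 h x"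
    and "b * ((p0 h x)\<^sup>2 + (p1 h x)\<^sup>2 - (p2 h x)\<^sup>2 - (p3 h x)\<^sup>2) = 2 * a * (p1 h x * p2 h x + p0 h x * p3 h x)"
proof -
  have fr: "f \<in> slice_regular \<Omega>"
    and fI: "\<And>x. of_real x \<in> \<Omega> \<Longrightarrow> f (of_real x) \<in> slice_plane I"
    using f by (auto simp: one_slice_preserving_iff I)
  \<comment> \<open>As \<open>f\<close> is not slice preserving it takes a nonreal value at a real
    point, so its trace \<open>p1 f\<close> is not identically zero.\<close>
  obtain y where y: "of_real y \<in> \<Omega>" "f (of_real y) \<notin> \<real>"
    using f fr by (auto simp: slice_preserving_iff)
  have rep: "q = rot I J (Quat (inner q 1) (inner q I) (inner q J) (inner q (I * J)))" for q
    by (rule rot_surjE [OF I J IJ, of q])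
      (simp only: inner_rot_units [OF I J IJ] quat.collapse)
  have frep: "f (of_real x) = rot I J (Quat (p0 f x) (p1 f x) 0 0)" if "of_real x \<in> \<Omega>" for x
    using rep [of "f (of_real x)"] fI [OF that]
    by (simp add: mem_slice_plane_iff_inner [OF I J IJ] p0_def p1_def)
  have "p1 f y \<noteq> 0"
    using frep [OF y(1)] y(2) by (auto simp: rot_def Reals_def of_real_def)
  have eqs: "p1 f x * (2 * (p1 h x * p3 h x - p0 h x * p2 h x)) = 0"
    "p1 f x * (b * (p0 h x * p0 h x + p1 h x * p1 h x - p2 h x * p2 h x - p3 h x * p3 h x)
        - 2 * a * (p1 h x * p2 h x + p0 h x * p3 h x)) = 0"
    if "of_real x \<in> \<Omega>" for x
  proof -
    define H where "H = Quat (p0 h x) (p1 h x) (p2 h x) (p3 h x)"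
    define F where "F = Quat (p0 f x) (p1 f x) 0 0"
    have "h (of_real x) = rot I J H"
      using rep [of "h (of_real x)"] by (simp add: H_def p0_def p1_def p2_def p3_def)
    then have "rot I J (H * F * qcnj H) \<in> slice_plane (a *\<^sub>R I + b *\<^sub>R J)"
      using mem [OF that] frep [OF that]
      by (simp add: rot_mult [OF I J IJ] qcnj_rot [OF I J IJ] F_def)
    note * = rot_mem_slice_plane_comb [OF I J IJ this]
    show "p1 f x * (2 * (p1 h x * p3 h x - p0 h x * p2 h x)) = 0"
      using *(1) by (simp add: H_def F_def algebra_simps)
    show "p1 f x * (b * (p0 h x * p0 h x + p1 h x * p1 h x - p2 h x * p2 h x - p3 h x * p3 h x)
        - 2 * a * (p1 h x * p2 h x + p0 h x * p3 h x)) = 0"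
      using *(2) by (simp add: H_def F_def algebra_simps)
  qed
  have tr: "p0 k \<in> real_traces" "p1 k \<in> real_traces" "p2 k \<in> real_traces" "p3 k \<in> real_traces"
    if "k \<in> slice_regular \<Omega>" for k
    unfolding p0_def p1_def p2_def p3_def by (intro real_traces_inner that)+
  note tr' = tr [OF h] tr(2) [OF fr]
  have "(\<forall>x. of_real x \<in> \<Omega> \<longrightarrow> p1 f x = 0) \<or>
      (\<forall>x. of_real x \<in> \<Omega> \<longrightarrow> 2 * (p1 h x * p3 h x - p0 h x * p2 h x) = 0)"
    using eqs(1) by (intro real_traces_integral real_traces_intros tr')
  then show "p1 h x * p3 h x = p0 h x * p2 h x"
    using y(1) \<open>p1 f y \<noteq> 0\<close> x by auto
  have "(\<forall>x. of_real x \<in> \<Omega> \<longrightarrow> p1 f x = 0) \<or>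
      (\<forall>x. of_real x \<in> \<Omega> \<longrightarrow> b * (p0 h x * p0 h x + p1 h x * p1 h x - p2 h x * p2 h x - p3 h x * p3 h x)
        - 2 * a * (p1 h x * p2 h x + p0 h x * p3 h x) = 0)"
    using eqs(2) by (intro real_traces_integral real_traces_intros tr')
  then show "b * ((p0 h x)\<^sup>2 + (p1 h x)\<^sup>2 - (p2 h x)\<^sup>2 - (p3 h x)\<^sup>2) = 2 * a * (p1 h x * p2 h x + p0 h x * p3 h x)"
    using y(1) \<open>p1 f y \<noteq> 0\<close> x by (auto simp: power2_eq_square)
qed

lemma not_slice_preserving_trace:
  assumes "I \<in> imag_units" "J \<in> imag_units" "inner I J = 0"
    and "h \<in> slice_regular \<Omega> - one_slice_preserving \<Omega> I"
  obtains y where "of_real y \<in> \<Omega>"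
    "inner (h (of_real y)) J \<noteq> 0 \<or> inner (h (of_real y)) (I * J) \<noteq> 0"
  using assms by (auto simp: one_slice_preserving_iff mem_slice_plane_iff_inner)

text \<open>Since a^2 + b^2 = 1, the roots of b t^2 - 2 a t - b are (a + 1) / b and (a - 1) / b. The
  integral domain property selects one root for each pair of traces, and \<open>A\<close> reconciles
  the two selections.\<close>

lemma trace_ratio:
  assumes tr: "p0 \<in> real_traces" "p1 \<in> real_traces" "p2 \<in> real_traces" "p3 \<in> real_traces"
    and ab: "b > 0" "a\<^sup>2 + b\<^sup>2 = 1"
    and A: "\<And>x. of_real x \<in> \<Omega> \<Longrightarrow> p1 x * p3 x = p0 x * p2 x"
    and B: "\<And>x. of_real x \<in> \<Omega> \<Longrightarrow>
      b * ((p0 x)\<^sup>2 + (p1 x)\<^sup>2 - (p2 x)\<^sup>2 - (p3 x)\<^sup>2) = 2 * a * (p1 x * p2 x + p0 x * p3 x)"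
    and y: "of_real y \<in> \<Omega>" "p2 y \<noteq> 0 \<or> p3 y \<noteq> 0"
  obtains s where "s \<in> {1, -1}"
    "\<And>x. of_real x \<in> \<Omega> \<Longrightarrow> b * p2 x = - (a + s) * p1 x \<and> b * p3 x = - (a + s) * p0 x"
proof -
  let ?Z = "\<lambda>u. \<forall>x. of_real x \<in> \<Omega> \<longrightarrow> u x = 0"
  \<comment> \<open>The two signs are the two linear factors:
    \<open>L u v 1 x * L u v (-1) x\<close> is b (b u^2 + 2 a u v - b v^2) at x.\<close>
  define L where "L = (\<lambda>(u :: real \<Rightarrow> real) v s x. b * u x + (a + s) * v x)"
  have L: "L u v s \<in> real_traces" if "u \<in> real_traces" "v \<in> real_traces" for u v s
    unfolding L_def by (intro real_traces_intros that)
  define N where "N = (\<lambda>x. p0 x * p0 x + p1 x * p1 x)"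
  have N: "N \<in> real_traces"
    unfolding N_def by (intro real_traces_intros tr)
  have "\<not> ?Z N"
  proof
    assume "?Z N"
    then have "p0 y = 0" "p1 y = 0"
      using y(1) by (auto simp: N_def sum_squares_eq_zero_iff)
    \<comment> \<open>With \<open>p0\<close> and \<open>p1\<close> zero at \<open>y\<close>,
      \<open>B\<close> forces \<open>p2\<close> and \<open>p3\<close> to vanish there as
      well.\<close>
    then have "b * ((p2 y)\<^sup>2 + (p3 y)\<^sup>2) = 0"
      using B [OF y(1)] by (simp add: algebra_simps)
    then show False
      using ab(1) y(2) by simp
  qed
  have split: "\<exists>s\<in>{1, -1}. ?Z (L u v s)"
    if uv: "u \<in> real_traces" "v \<in> real_traces"
      and 0: "\<And>x. of_real x \<in> \<Omega> \<Longrightarrow> N x * (L u v 1 x * L u v (-1) x) = 0" for u v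
  proof -
    have "?Z N \<or> ?Z (\<lambda>x. L u v 1 x * L u v (-1) x)"
      using 0 by (intro real_traces_integral N real_traces_mult L uv)
    then have "?Z (L u v 1) \<or> ?Z (L u v (-1))"
      using \<open>\<not> ?Z N\<close> by (intro real_traces_integral L uv) auto
    then show ?thesis
      by blast
  qed
  have "\<exists>s\<in>{1, -1}. ?Z (L p3 p0 s)"
  proof (rule split [OF tr(4,1)])
    fix x assume "of_real x \<in> \<Omega>"
    \<comment> \<open>Multiplying by \<open>N\<close> and using \<open>A\<close> rewrites the
      quadratic form in \<open>p3\<close> and \<open>p0\<close> as p0^2 times the one in
      \<open>B\<close>.\<close>
    from A [OF this] B [OF this] ab(2) show "N x * (L p3 p0 1 x * L p3 p0 (-1) x) = 0"
      unfolding N_def L_def by algebra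
  qed
  then obtain s where s: "s \<in> {1, -1}" "?Z (L p3 p0 s)"
    by blast
  have "\<exists>s\<in>{1, -1}. ?Z (L p2 p1 s)"
  proof (rule split [OF tr(3,2)])
    fix x assume "of_real x \<in> \<Omega>"
    from A [OF this] B [OF this] ab(2) show "N x * (L p2 p1 1 x * L p2 p1 (-1) x) = 0"
      unfolding N_def L_def by algebra
  qed
  then obtain s' where s': "s' \<in> {1, -1}" "?Z (L p2 p1 s')"
    by blast
  \<comment> \<open>The signs \<open>s\<close> and \<open>s'\<close> may differ. By
    \<open>A\<close>, \<open>p0\<close> times \<open>L p2 p1 s\<close> equals \<open>p1\<close>
    times \<open>L p3 p0 s\<close>, which is zero; so either \<open>s\<close> serves both pairs, or
    \<open>p0\<close> and then \<open>p3\<close> vanish and \<open>s'\<close> does.\<close>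
  have "?Z p0 \<or> ?Z (L p2 p1 s)"
  proof (intro real_traces_integral L tr)
    fix x assume x: "of_real x \<in> \<Omega>"
    have "L p3 p0 s x = 0"
      using s(2) x by simp
    with A [OF x] show "p0 x * L p2 p1 s x = 0"
      unfolding L_def by algebra
  qed
  then show ?thesis
  proof
    assume "?Z (L p2 p1 s)"
    with s show ?thesis
      by (intro that [of s]) (auto simp: L_def algebra_simps)
  next
    assume "?Z p0"
    then have "?Z p3"
      using s(2) ab(1) by (auto simp: L_def)
    with \<open>?Z p0\<close> s' show ?thesis
      by (intro that [of s']) (auto simp: L_def algebra_simps)
  qed
qed

lemma star_conj_imp_distinct:
  assumes I: "I \<in> imag_units" and K: "K \<in> imag_units" and IK: "inner I K = 0"
    and ab: "b > 0" "a\<^sup>2 + b\<^sup>2 = 1"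
    and f: "f \<in> one_slice_preserving \<Omega> I - slice_preserving \<Omega>"
    and h: "h \<in> slice_regular \<Omega> - one_slice_preserving \<Omega> I"
    and mem: "\<And>x. of_real x \<in> \<Omega> \<Longrightarrow>
      h (of_real x) * f (of_real x) * qcnj (h (of_real x)) \<in> slice_plane (a *\<^sub>R I + b *\<^sub>R (K * I))"
  shows "\<exists>g\<in>one_slice_preserving \<Omega> I. (\<exists>q\<in>\<Omega>. g q \<noteq> 0) \<and>
    (\<exists>s\<in>{1, - 1}. \<forall>q\<in>\<Omega>. h q = star_prod \<Omega> (\<lambda>_. 1 - ((a + s) / b) *\<^sub>R K) g q)"
proof -
  have anti: "K * I = - (I * K)"
    by (rule imag_units_anticommute [OF I K IK])
  have J: "K * I \<in> imag_units" "inner I (K * I) = 0"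
    using imag_units_mult [OF I K IK] by (simp_all add: anti uminus_imag_unit)
  \<comment> \<open>In the frame with second unit \<open>K * I\<close> the third unit is
    \<open>K\<close>, so the constant factor has only a real and a third coordinate.\<close>
  have IJ: "I * (K * I) = K"
    by (simp add: anti imag_unit_square_left [OF I])
  have hr: "h \<in> slice_regular \<Omega>"
    using h by simp
  obtain y where y: "of_real y \<in> \<Omega>"
    "inner (h (of_real y)) (K * I) \<noteq> 0 \<or> inner (h (of_real y)) (I * (K * I)) \<noteq> 0"
    using not_slice_preserving_trace [OF I J h] by blast
  obtain s where s: "s \<in> {1, -1}" and eq: "\<And>x. of_real x \<in> \<Omega> \<Longrightarrow>
      b * inner (h (of_real x)) (K * I) = - (a + s) * inner (h (of_real x)) I \<and>
      b * inner (h (of_real x)) (I * (K * I)) = - (a + s) * inner (h (of_real x)) 1"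
    by (rule trace_ratio [OF real_traces_inner [OF hr] real_traces_inner [OF hr]
          real_traces_inner [OF hr] real_traces_inner [OF hr] ab conj_equations [OF I J f hr mem] y])
      (assumption | blast)+
  let ?c = "1 - ((a + s) / b) *\<^sub>R K"
  have "qRe ?c = 1"
    using K by (simp add: imag_units_iff)
  then have "?c \<noteq> 0"
    by (metis zero_neq_one zero_quat.simps(1))
  have "\<exists>p\<in>slice_plane I. h (of_real x) = ?c * p" if x: "of_real x \<in> \<Omega>" for x
  proof -
    obtain P where P: "h (of_real x) = rot I (K * I) P"
      by (rule rot_surjE [OF I J])
    have "b * qIm2 P = - (a + s) * qIm1 P" "b * qIm3 P = - (a + s) * qRe P"
      using eq [OF x] by (simp_all only: P inner_rot_units [OF I J])
    then have 23: "qIm2 P = - ((a + s) / b) * qIm1 P" "qIm3 P = - ((a + s) / b) * qRe P"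
      using ab(1) by (simp_all add: field_simps)
    have "?c = rot I (K * I) (Quat 1 0 0 (- ((a + s) / b)))"
      by (simp add: rot_def IJ)
    \<comment> \<open>The ratios say exactly that \<open>P\<close> is (1 - t k)(x + y i) with t = (a
      + s) / b, because k i = j.\<close>
    moreover have "P = Quat 1 0 0 (- ((a + s) / b)) * Quat (qRe P) (qIm1 P) 0 0"
      by (simp add: quat_eq_iff 23)
    ultimately have "h (of_real x) = ?c * rot I (K * I) (Quat (qRe P) (qIm1 P) 0 0)"
      using P rot_mult [OF I J] by metis
    moreover have "rot I (K * I) (Quat (qRe P) (qIm1 P) 0 0) \<in> slice_plane I"
      by (simp add: rot_mem_slice_plane [OF I J])
    ultimately show ?thesis
      by blast
  qed
  from star_const_factorization [OF h I \<open>?c \<noteq> 0\<close> this] s show ?thesis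
    by blast
qed

lemma star_conj_imp_same:
  assumes I: "I \<in> imag_units"
    and f: "f \<in> one_slice_preserving \<Omega> I - slice_preserving \<Omega>"
    and h: "h \<in> slice_regular \<Omega> - one_slice_preserving \<Omega> I"
    and mem: "\<And>x. of_real x \<in> \<Omega> \<Longrightarrow>
      h (of_real x) * f (of_real x) * qcnj (h (of_real x)) \<in> slice_plane I"
  shows "\<exists>J\<in>imag_units. orthogonal I J \<and> (\<exists>g\<in>one_slice_preserving \<Omega> I. (\<exists>q\<in>\<Omega>. g q \<noteq> 0) \<and>
    (\<forall>q\<in>\<Omega>. h q = star_prod \<Omega> (\<lambda>_. J) g q))"
proof -
  obtain J where J: "J \<in> imag_units" "inner I J = 0"
    by (rule exists_orthogonal_imag_unit)
  have hr: "h \<in> slice_regular \<Omega>"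
    using h by simp
  define p where "p = (\<lambda>w x. inner (h (of_real x)) w)"
  have tr: "p w \<in> real_traces" for w
    unfolding p_def by (rule real_traces_inner [OF hr])
  \<comment> \<open>The coinciding planes are the case a = 1, b = 0 of the conjugation equations,
    with \<open>J\<close> any unit orthogonal to \<open>I\<close>.\<close>
  have mem': "h (of_real x) * f (of_real x) * qcnj (h (of_real x)) \<in> slice_plane (1 *\<^sub>R I + 0 *\<^sub>R J)"
    if "of_real x \<in> \<Omega>" for x
    using mem [OF that] by simp
  have eqs: "p I x * p (I * J) x = p 1 x * p J x" "p I x * p J x + p 1 x * p (I * J) x = 0"
    if "of_real x \<in> \<Omega>" for x
    using conj_equations [OF I J f hr mem' that] by (simp_all add: p_def)
  obtain y where y: "of_real y \<in> \<Omega>" "p J y \<noteq> 0 \<or> p (I * J) y \<noteq> 0"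
    unfolding p_def using not_slice_preserving_trace [OF I J h] by blast
  have vanish: "p w x = 0" if w: "w = 1 \<or> w = I" and x: "of_real x \<in> \<Omega>" for w x
  proof -
    \<comment> \<open>The equations are linear in the coordinates along 1 and \<open>I\<close>, with
      determinant up to sign the sum of squares of the other two. That sum is nonzero at
      \<open>y\<close>, so the integral domain property leaves only the first alternative.\<close>
    have "(\<forall>x. of_real x \<in> \<Omega> \<longrightarrow> p w x = 0) \<or>
        (\<forall>x. of_real x \<in> \<Omega> \<longrightarrow> p J x * p J x + p (I * J) x * p (I * J) x = 0)"
    proof (intro real_traces_integral real_traces_intros tr)
      fix x assume "of_real x \<in> \<Omega>"
      note e = eqs [OF this]
      from e have "p 1 x * (p J x * p J x + p (I * J) x * p (I * J) x) = 0"
        by algebra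
      moreover from e have "p I x * (p J x * p J x + p (I * J) x * p (I * J) x) = 0"
        by algebra
      ultimately show "p w x * (p J x * p J x + p (I * J) x * p (I * J) x) = 0"
        using w by blast
    qed
    then show ?thesis
      using x y by (auto simp: sum_squares_eq_zero_iff)
  qed
  have "J \<noteq> 0"
    using J by (auto simp: imag_units_iff_norm)
  have "\<exists>c\<in>slice_plane I. h (of_real x) = J * c" if x: "of_real x \<in> \<Omega>" for x
  proof -
    obtain P where P: "h (of_real x) = rot I J P"
      by (rule rot_surjE [OF I J])
    have "qRe P = 0" "qIm1 P = 0"
      using vanish [OF _ x, of 1] vanish [OF _ x, of I] by (simp_all add: p_def P inner_rot_units [OF I J])
    \<comment> \<open>Since j i = - k, the element x j + y k equals j (x - y i).\<close>
    then have "P = quat_j * Quat (qIm2 P) (- qIm3 P) 0 0"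
      by (simp add: quat_eq_iff)
    then have "h (of_real x) = J * rot I J (Quat (qIm2 P) (- qIm3 P) 0 0)"
      using P rot_mult [OF I J] rot_units(3) by metis
    moreover have "rot I J (Quat (qIm2 P) (- qIm3 P) 0 0) \<in> slice_plane I"
      by (simp add: rot_mem_slice_plane [OF I J])
    ultimately show ?thesis
      by blast
  qed
  from star_const_factorization [OF h I \<open>J \<noteq> 0\<close> this] J show ?thesis
    by (auto simp: orthogonal_def)
qed

text \<open>For the converse: with h = c g, the inner part g f g^c stays in the plane of
  \<open>I\<close>, which is closed under products and conjugation. Only conjugation by the constant
  \<open>c\<close> remains.\<close>

lemma star_factor_conj:
  assumes I: "I \<in> imag_units" and J: "J \<in> imag_units" "inner I J = 0"
    and f: "f \<in> one_slice_preserving \<Omega> I" and g: "g \<in> one_slice_preserving \<Omega> I"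
    and h: "\<forall>q\<in>\<Omega>. h q = star_prod \<Omega> (\<lambda>_. c) g q"
    and x: "of_real x \<in> \<Omega>"
  obtains u v where "h (of_real x) * f (of_real x) * qcnj (h (of_real x)) =
    c * rot I J (Quat u v 0 0) * qcnj c"
proof -
  have g': "g \<in> slice_regular \<Omega>" "g (of_real x) \<in> slice_plane I" "f (of_real x) \<in> slice_plane I"
    using f g x by (auto simp: one_slice_preserving_iff I)
  obtain F G where F: "f (of_real x) = rot I J F" and G: "g (of_real x) = rot I J G"
    using rot_surjE [OF I J] by metis
  have "h (of_real x) = c * rot I J G"
    using h x G star_prod_of_real [OF slice_regular_const g'(1) x] by simp
  moreover have "rot I J G * rot I J F * qcnj (rot I J G) = rot I J (G * F * qcnj G)"
    by (simp add: rot_mult [OF I J] qcnj_rot [OF I J])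
  moreover have "qIm2 (G * F * qcnj G) = 0" "qIm3 (G * F * qcnj G) = 0"
    using g'(2,3) by (simp_all add: F G rot_mem_slice_plane [OF I J])
  then have "G * F * qcnj G = Quat (qRe (G * F * qcnj G)) (qIm1 (G * F * qcnj G)) 0 0"
    by (simp only: quat_eq_iff quat.sel simp_thms)
  ultimately have "h (of_real x) * f (of_real x) * qcnj (h (of_real x)) =
      c * rot I J (Quat (qRe (G * F * qcnj G)) (qIm1 (G * F * qcnj G)) 0 0) * qcnj c"
    by (metis F qcnj_mult mult.assoc)
  then show ?thesis
    by (rule that)
qed

end

theorem theorem5p4:
  fixes \<Omega> :: "quat set" and I\<^sub>0 M\<^sub>0 :: quat and f h :: "quat \<Rightarrow> quat"
  assumes "symmetric_slice_domain \<Omega>"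
    and "I\<^sub>0 \<in> imag_units"
    and "f \<in> one_slice_preserving \<Omega> I\<^sub>0 - slice_preserving \<Omega>"
    and "h \<in> slice_regular \<Omega> - one_slice_preserving \<Omega> I\<^sub>0"
    and "M\<^sub>0 \<in> imag_units"
  shows "star_prod \<Omega> (star_prod \<Omega> h f) (regular_conj \<Omega> h) \<in> one_slice_preserving \<Omega> M\<^sub>0 \<longleftrightarrow>
    (slice_plane I\<^sub>0 \<noteq> slice_plane M\<^sub>0 \<longrightarrow>
      (let K\<^sub>0 = qcross I\<^sub>0 M\<^sub>0 /\<^sub>R norm (qcross I\<^sub>0 M\<^sub>0); J\<^sub>0 = K\<^sub>0 * I\<^sub>0 in
        \<exists>a b :: real. M\<^sub>0 = a *\<^sub>R I\<^sub>0 + b *\<^sub>R J\<^sub>0 \<and> b > 0 \<and> a\<^sup>2 + b\<^sup>2 = 1 \<and>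
          (\<exists>g \<in> one_slice_preserving \<Omega> I\<^sub>0. (\<exists>q\<in>\<Omega>. g q \<noteq> 0) \<and>
            (\<exists>s \<in> {1, - 1}. \<forall>q\<in>\<Omega>. h q = star_prod \<Omega> (\<lambda>_. 1 - ((a + s) / b) *\<^sub>R K\<^sub>0) g q)))) \<and>
    (slice_plane I\<^sub>0 = slice_plane M\<^sub>0 \<longrightarrow>
      (\<exists>J\<^sub>0 \<in> imag_units. orthogonal I\<^sub>0 J\<^sub>0 \<and>
        (\<exists>g \<in> one_slice_preserving \<Omega> I\<^sub>0. (\<exists>q\<in>\<Omega>. g q \<noteq> 0) \<and>
          (\<forall>q\<in>\<Omega>. h q = star_prod \<Omega> (\<lambda>_. J\<^sub>0) g q))))"
proof -
  interpret slice_domain \<Omega>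
    by unfold_locales (rule assms(1))
  note I = assms(2) and f = assms(3) and h = assms(4) and M = assms(5)
  have fI: "f \<in> one_slice_preserving \<Omega> I\<^sub>0"
    using f by simp
  have iff: "star_prod \<Omega> (star_prod \<Omega> h f) (regular_conj \<Omega> h) \<in> one_slice_preserving \<Omega> M\<^sub>0 \<longleftrightarrow>
    (\<forall>x. of_real x \<in> \<Omega> \<longrightarrow> h (of_real x) * f (of_real x) * qcnj (h (of_real x)) \<in> slice_plane M\<^sub>0)"
    using f h M by (intro star_conj_mem_iff) (auto simp: one_slice_preserving_def)
  show ?thesis
  proof (cases "slice_plane I\<^sub>0 = slice_plane M\<^sub>0")
    case True
    have "h (of_real x) * f (of_real x) * qcnj (h (of_real x)) \<in> slice_plane I\<^sub>0"
      if J: "J \<in> imag_units" "orthogonal I\<^sub>0 J" and g: "g \<in> one_slice_preserving \<Omega> I\<^sub>0"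
        and hg: "\<forall>q\<in>\<Omega>. h q = star_prod \<Omega> (\<lambda>_. J) g q" and x: "of_real x \<in> \<Omega>" for J g x
    proof -
      have IJ: "inner I\<^sub>0 J = 0"
        using J by (simp add: orthogonal_def)
      obtain u v where "h (of_real x) * f (of_real x) * qcnj (h (of_real x)) =
          J * rot I\<^sub>0 J (Quat u v 0 0) * qcnj J"
        by (rule star_factor_conj [OF I J(1) IJ fI g hg x])
      \<comment> \<open>Conjugation by j sends u + v i to u - v i and so preserves the
        plane.\<close>
      also have "\<dots> = rot I\<^sub>0 J (quat_j * Quat u v 0 0 * qcnj quat_j)"
        by (simp add: rot_mult [OF I J(1) IJ] flip: qcnj_rot [OF I J(1) IJ])
      finally show ?thesis
        by (simp add: rot_mem_slice_plane [OF I J(1) IJ])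
    qed
    then show ?thesis
      using True star_conj_imp_same [OF I f h] iff by (auto simp del: insert_iff)
  next
    case False
    let ?K = "qcross I\<^sub>0 M\<^sub>0 /\<^sub>R norm (qcross I\<^sub>0 M\<^sub>0)"
    obtain b where b: "b > 0" and K: "?K \<in> imag_units" "inner I\<^sub>0 ?K = 0"
      and Meq: "M\<^sub>0 = inner I\<^sub>0 M\<^sub>0 *\<^sub>R I\<^sub>0 + b *\<^sub>R (?K * I\<^sub>0)" and ab: "(inner I\<^sub>0 M\<^sub>0)\<^sup>2 + b\<^sup>2 = 1"
      by (rule orthonormal_frame [OF I M False])
    define K where "K = ?K"
    note K = K [folded K_def] and Meq = Meq [folded K_def]
    have anti: "K * I\<^sub>0 = - (I\<^sub>0 * K)"
      by (rule imag_units_anticommute [OF I K])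
    have J: "K * I\<^sub>0 \<in> imag_units" "inner I\<^sub>0 (K * I\<^sub>0) = 0"
      using imag_units_mult [OF I K] by (simp_all add: anti uminus_imag_unit)
    have IJ: "I\<^sub>0 * (K * I\<^sub>0) = K"
      by (simp add: anti imag_unit_square_left [OF I])
    have factor: "h (of_real x) * f (of_real x) * qcnj (h (of_real x)) \<in> slice_plane M\<^sub>0"
      if Mab: "M\<^sub>0 = a *\<^sub>R I\<^sub>0 + b *\<^sub>R (K * I\<^sub>0)" "b > 0" "a\<^sup>2 + b\<^sup>2 = 1"
        and s: "s \<in> {1, -1}" and g: "g \<in> one_slice_preserving \<Omega> I\<^sub>0"
        and hg: "\<forall>q\<in>\<Omega>. h q = star_prod \<Omega> (\<lambda>_. 1 - ((a + s) / b) *\<^sub>R K) g q"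
        and x: "of_real x \<in> \<Omega>" for a b s g x
    proof -
      define l where "l = (a + s) / b"
      have "s\<^sup>2 = 1"
        using s by auto
      moreover have "l * b = a + s"
        using Mab(2) by (simp add: l_def)
      \<comment> \<open>\<open>l\<close> is a root of b t^2 - 2 a t - b; the relation is obtained
        with an extra factor \<open>b\<close>, which is then cancelled.\<close>
      ultimately have "b * (b * (1 - l\<^sup>2)) = b * (- 2 * l * a)"
        using Mab(3) by algebra
      then have "b * (1 - l\<^sup>2) = - 2 * l * a"
        unfolding mult_left_cancel [OF less_imp_neq [OF Mab(2), symmetric]] .
      \<comment> \<open>This makes the vector (1 - l^2, - 2 l) the multiple of (a, b) by - 2 l / b,
        so the rotated imaginary part is parallel to \<open>M\<^sub>0\<close>.\<close>
      then have l: "1 - l\<^sup>2 = - 2 * l / b * a"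
        using Mab(2) by (simp add: field_simps)
      obtain u v where "h (of_real x) * f (of_real x) * qcnj (h (of_real x)) =
          (1 - l *\<^sub>R K) * rot I\<^sub>0 (K * I\<^sub>0) (Quat u v 0 0) * qcnj (1 - l *\<^sub>R K)"
        unfolding l_def by (rule star_factor_conj [OF I J fI g hg x])
      also have "1 - l *\<^sub>R K = rot I\<^sub>0 (K * I\<^sub>0) (Quat 1 0 0 (- l))"
        by (simp add: rot_def IJ)
      also have "\<dots> * rot I\<^sub>0 (K * I\<^sub>0) (Quat u v 0 0) * qcnj \<dots>
          = rot I\<^sub>0 (K * I\<^sub>0) (Quat 1 0 0 (- l) * Quat u v 0 0 * qcnj (Quat 1 0 0 (- l)))"
        by (simp add: rot_mult [OF I J] qcnj_rot [OF I J])
      also have "Quat 1 0 0 (- l) * Quat u v 0 0 * qcnj (Quat 1 0 0 (- l))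
          = Quat (u * (1 + l\<^sup>2)) (v * (1 - l\<^sup>2)) (- 2 * l * v) 0"
        by (simp add: quat_eq_iff algebra_simps power2_eq_square)
      also have "rot I\<^sub>0 (K * I\<^sub>0) \<dots> = of_real (u * (1 + l\<^sup>2)) + (- 2 * l / b * v) *\<^sub>R M\<^sub>0"
        using Mab(2) by (simp add: rot_def l Mab(1) of_real_def algebra_simps)
      finally show ?thesis
        unfolding slice_plane_iff by blast
    qed
    have "star_prod \<Omega> (star_prod \<Omega> h f) (regular_conj \<Omega> h) \<in> one_slice_preserving \<Omega> M\<^sub>0 \<longleftrightarrow>
        (\<exists>a b :: real. M\<^sub>0 = a *\<^sub>R I\<^sub>0 + b *\<^sub>R (K * I\<^sub>0) \<and> b > 0 \<and> a\<^sup>2 + b\<^sup>2 = 1 \<and>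
          (\<exists>g \<in> one_slice_preserving \<Omega> I\<^sub>0. (\<exists>q\<in>\<Omega>. g q \<noteq> 0) \<and>
            (\<exists>s \<in> {1, - 1}. \<forall>q\<in>\<Omega>. h q = star_prod \<Omega> (\<lambda>_. 1 - ((a + s) / b) *\<^sub>R K) g q)))" (is "?L \<longleftrightarrow> ?R")
    proof
      assume ?L
      have "slice_plane M\<^sub>0 = slice_plane (inner I\<^sub>0 M\<^sub>0 *\<^sub>R I\<^sub>0 + b *\<^sub>R (K * I\<^sub>0))"
        using Meq by (rule arg_cong)
      then have "h (of_real x) * f (of_real x) * qcnj (h (of_real x))
          \<in> slice_plane (inner I\<^sub>0 M\<^sub>0 *\<^sub>R I\<^sub>0 + b *\<^sub>R (K * I\<^sub>0))" if "of_real x \<in> \<Omega>" for x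
        using \<open>?L\<close> that unfolding iff by blast
      from star_conj_imp_distinct [OF I K b ab f h this] Meq b ab show ?R
        by blast
    next
      assume ?R
      then show ?L
        unfolding iff using factor by blast
    qed
    then show ?thesis
      using False by (simp add: Let_def K_def)
  qed
qed

end
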